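(* Let $\bm P$ be a Beta Markov stick-breaking process with parameters $(N,\bm\alpha,\bm\beta,P_0)$ and weights $\bm w$. Then: (i) if $\sum_{j\ge1}\alpha_j/(\alpha_j+\beta_j)=\infty$ and $\limsup_{j\to\infty}(\alpha_j+\beta_j)^{-1}<\infty$, then $\bm P$ is proper; (ii) for every $j\ge1$, $w_j>0$ a.s.; (iii) $\bm P$ has full support.
   Context: Let $N\in\{0,1,\dots\}$ and $\bm\alpha=(\alpha_j)$, $\bm\beta=(\beta_j)$ sequences of positive numbers; $F_j(v)=\mathcal I_v(\alpha_j,\beta_j)$ (the $\mathrm{Beta}(\alpha_j,\beta_j)$ distribution function) and $\Upsilon_j=F_{j+1}^{-1}\circ F_j$. A Beta Markov stick-breaking process (BMSBp) with parameters $(N,\bm\alpha,\bm\beta,P_0)$ is $\bm P=\sum_jw_j\delta_{\theta_j}+(1-\sum_jw_j)P_0$ where $w_1=v_1$, $w_j=v_j\prod_{i<j}(1-v_i)$, $\bm v$ is a Markov chain with $v_1\sim\mathrm{Beta}(\alpha_1,\beta_1)$ and transitions $\mathbb P[v_{j+1}\in du\mid v_j=v]=\sum_{z=0}^N\mathrm{Beta}(du\mid\alpha_{j+1}+z,\beta_{j+1}+N-z)\binom Nz\Upsilon_j(v)^z(1-\Upsilon_j(v))^{N-z}$, $P_0$ is a diffuse probability measure on a complete separable metric space $\mathbb X$, and $\theta_j$ are iid $P_0$ independent of $\bm w$. Proper means $\sum_jw_j=1$ a.s.; full support means every probability measure on $\mathbb X$ with support contained in that of $P_0$ lies in the weak-topology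 support of the law of $\bm P$. *)

theory Defs
  imports "HOL-Probability.Probability"
begin

definition beta_density :: "real \<Rightarrow> real \<Rightarrow> real \<Rightarrow> real" where
  "beta_density a b x =
     indicator {0<..<1} x * x powr (a - 1) * (1 - x) powr (b - 1) / Beta a b"

definition beta_measure :: "real \<Rightarrow> real \<Rightarrow> real measure" where
  "beta_measure a b = density lborel (\<lambda>x. ennreal (beta_density a b x))"

definition beta_cdf :: "real \<Rightarrow> real \<Rightarrow> real \<Rightarrow> real" where
  "beta_cdf a b = cdf (beta_measure a b)"

text \<open>Upsilon_j = F_{j+1}^{-1} o F_j  (F_{j+1} is a bijection of [0,1]).\<close>
definition Ups :: "(nat \<Rightarrow> real) \<Rightarrow> (nat \<Rightarrow> real) \<Rightarrow> nat \<Rightarrow> real \<Rightarrow> real" where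
  "Ups \<alpha> \<beta> j v =
     inv_into {0..1} (beta_cdf (\<alpha> (Suc j)) (\<beta> (Suc j))) (beta_cdf (\<alpha> j) (\<beta> j) v)"

definition bmsb_kernel ::
  "nat \<Rightarrow> (nat \<Rightarrow> real) \<Rightarrow> (nat \<Rightarrow> real) \<Rightarrow> nat \<Rightarrow> real \<Rightarrow> real set \<Rightarrow> real" where
  "bmsb_kernel N \<alpha> \<beta> j v A =
     (\<Sum>z\<le>N. real (N choose z) * Ups \<alpha> \<beta> j v ^ z * (1 - Ups \<alpha> \<beta> j v) ^ (N - z)
        * measure (beta_measure (\<alpha> (Suc j) + real z) (\<beta> (Suc j) + real (N - z))) A)"

text \<open>v is a Markov chain with v_0 ~ Beta(alpha_0,beta_0) and transition kernels
  bmsb_kernel (finite-dimensional distributions via the Markov property).\<close>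
definition bmsb_chain ::
  "'w measure \<Rightarrow> nat \<Rightarrow> (nat \<Rightarrow> real) \<Rightarrow> (nat \<Rightarrow> real) \<Rightarrow> (nat \<Rightarrow> 'w \<Rightarrow> real) \<Rightarrow> bool" where
  "bmsb_chain M N \<alpha> \<beta> v \<longleftrightarrow>
     (\<forall>j. v j \<in> borel_measurable M) \<and>
     distr M borel (v 0) = beta_measure (\<alpha> 0) (\<beta> 0) \<and>
     (\<forall>n (A :: nat \<Rightarrow> real set). (\<forall>i. A i \<in> sets borel) \<longrightarrow>
        measure M {\<omega> \<in> space M. \<forall>i\<le>Suc n. v i \<omega> \<in> A i} =
        (\<integral>\<omega>. indicator {\<omega>. \<forall>i\<le>n. v i \<omega> \<in> A i} \<omega>
                 * bmsb_kernel N \<alpha> \<beta> n (v n \<omega>) (A (Suc n)) \<partial>M))"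

definition stick_weight :: "(nat \<Rightarrow> 'w \<Rightarrow> real) \<Rightarrow> nat \<Rightarrow> 'w \<Rightarrow> real" where
  "stick_weight v j \<omega> = v j \<omega> * (\<Prod>i<j. 1 - v i \<omega>)"

definition sb_random_measure ::
  "'x::topological_space measure \<Rightarrow> (nat \<Rightarrow> 'w \<Rightarrow> real) \<Rightarrow> (nat \<Rightarrow> 'w \<Rightarrow> 'x) \<Rightarrow> 'w \<Rightarrow> 'x measure" where
  "sb_random_measure P0 v \<theta> \<omega> =
     measure_of UNIV (sets borel)
       (\<lambda>A. (\<Sum>j. ennreal (stick_weight v j \<omega>) * indicator A (\<theta> j \<omega>))
            + ennreal (1 - (\<Sum>j. stick_weight v j \<omega>)) * emeasure P0 A)"

definition msupport :: "'x::metric_space measure \<Rightarrow> 'x set" where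
  "msupport Q = {x. \<forall>e>0. emeasure Q (ball x e) > 0}"

text \<open>Q lies in the weak-topology support of the law of the random measure Pr:
  every basic weak neighbourhood of Q has positive probability.\<close>
definition in_weak_support ::
  "'w measure \<Rightarrow> ('w \<Rightarrow> 'x::metric_space measure) \<Rightarrow> 'x measure \<Rightarrow> bool" where
  "in_weak_support M Pr Q \<longleftrightarrow>
     (\<forall>(F :: ('x \<Rightarrow> real) set) (\<epsilon>::real).
        finite F \<and> (\<forall>f\<in>F. continuous_on UNIV f \<and> bounded (range f)) \<and> \<epsilon> > 0 \<longrightarrow>
        measure M {\<omega> \<in> space M. \<forall>f\<in>F. \<bar>(\<integral>x. f x \<partial>Pr \<omega>) - (\<integral>x. f x \<partial>Q)\<bar> < \<epsilon>} > 0)"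

definition full_support ::
  "'w measure \<Rightarrow> ('w \<Rightarrow> 'x::metric_space measure) \<Rightarrow> 'x measure \<Rightarrow> bool" where
  "full_support M Pr P0 \<longleftrightarrow>
     (\<forall>Q. prob_space Q \<and> sets Q = sets borel \<and> msupport Q \<subseteq> msupport P0
          \<longrightarrow> in_weak_support M Pr Q)"

end

theory Submission
  imports Defs
begin

text \<open>Given the past, \<open>v\<^bsub>j+1\<^esub>\<close> is a mixture over \<open>z \<le> N\<close> of Beta laws with mean at least
  \<open>q\<^bsub>j+1\<^esub> = \<alpha>\<^bsub>j+1\<^esub> / (\<alpha>\<^bsub>j+1\<^esub> + \<beta>\<^bsub>j+1\<^esub> + N)\<close>, so the expected remaining stick length shrinks by a factor
  \<open>1 - q\<^bsub>j+1\<^esub>\<close> at each step. The hypotheses of (i) make \<open>\<Sum> q\<^sub>j\<close> diverge, and the remaining length,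
  being monotone, vanishes almost surely. Each mixture charges every open subinterval of the unit
  interval, uniformly in the previous state; hence finitely many \<open>v\<^sub>j\<close> lie with positive probability
  close to any prescribed values, and independently so do the atoms \<open>\<theta>\<^sub>j\<close> in the support of \<open>P0\<close>.
  Full support follows by approximating a given law by a finitely supported one.\<close>

subsection \<open>Beta distributions\<close>

text \<open>The chain condition fixes only probabilities of rectangles, while the expected remaining
  length is the integral of a product of the functions \<open>1 - v i\<close>. So the Markov
  property has to be extended from indicators to products of nonnegative Borel functions. The next
  state then integrates against fixed Beta laws, because the previous state enters the kernel only
  through the binomial weights. The number \<open>q j\<close> is the mean of the component
  \<open>z = 0\<close>, the smallest of all; the limsup condition eventually keeps
  \<open>\<alpha> j + \<beta> j\<close> away from 0, so adding N to the denominator costs only a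
  bounded factor. For full support the infinite tail is controlled by the finite target: its weights
  sum to 1, so once the first m random weights are close to them, the leftover mass (later atoms and
  the multiple of \<open>P0\<close> together) is small. A target weight may force a stick variable
  to the value 0 or 1, which the Beta laws do not reach; its neighbourhoods still contain an open
  subinterval of the unit interval.\<close>

lemma Beta_real_pos: "a > 0 \<Longrightarrow> b > 0 \<Longrightarrow> Beta a b > (0::real)"
  by (simp add: Beta_def Gamma_real_pos)

lemma beta_density_nonneg: "a > 0 \<Longrightarrow> b > 0 \<Longrightarrow> beta_density a b x \<ge> 0"
  using Beta_real_pos[of a b] by (auto simp: beta_density_def intro!: divide_nonneg_pos)

lemma beta_density_pos: "a > 0 \<Longrightarrow> b > 0 \<Longrightarrow> 0 < x \<Longrightarrow> x < 1 \<Longrightarrow> beta_density a b x > 0"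
  using Beta_real_pos[of a b] by (auto simp: beta_density_def intro!: divide_pos_pos mult_pos_pos)

lemma borel_measurable_beta_density [measurable]: "beta_density a b \<in> borel_measurable borel"
  unfolding beta_density_def by measurable

lemma sets_beta_measure [measurable_cong, simp]: "sets (beta_measure a b) = sets borel"
  by (simp add: beta_measure_def)

lemma space_beta_measure [simp]: "space (beta_measure a b) = UNIV"
  by (simp add: beta_measure_def)

lemma nn_integral_beta_measure:
  assumes [measurable]: "f \<in> borel_measurable borel"
  shows "(\<integral>\<^sup>+u. f u \<partial>beta_measure a b) = (\<integral>\<^sup>+u. ennreal (beta_density a b u) * f u \<partial>lborel)"
  unfolding beta_measure_def by (rule nn_integral_density) measurable

lemma nn_integral_beta_density:
  assumes "a > 0" "b > 0"
  shows "(\<integral>\<^sup>+u. ennreal (beta_density a b u) \<partial>lborel) = 1"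
proof -
  have "((\<lambda>t. t powr (a - 1) * (1 - t) powr (b - 1) / Beta a b) has_integral Beta a b / Beta a b) {0..1}"
    by (intro has_integral_divide has_integral_Beta_real assms)
  then have I: "((\<lambda>t. t powr (a - 1) * (1 - t) powr (b - 1) / Beta a b) has_integral 1) {0..1}"
    using Beta_real_pos[OF assms] by simp
  have "(\<integral>\<^sup>+u. ennreal (beta_density a b u) \<partial>lborel)
      = (\<integral>\<^sup>+u. ennreal (indicator {0..1} u * (u powr (a - 1) * (1 - u) powr (b - 1) / Beta a b)) \<partial>lborel)"
    by (intro nn_integral_cong) (auto simp: beta_density_def indicator_def less_le)
  also have "\<dots> = ennreal 1"
    using I Beta_real_pos[OF assms] by (intro nn_integral_has_integral_lebesgue) auto
  finally show ?thesis by simp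
qed

lemma prob_space_beta_measure:
  assumes "a > 0" "b > 0"
  shows "prob_space (beta_measure a b)"
proof
  show "emeasure (beta_measure a b) (space (beta_measure a b)) = 1"
    using nn_integral_beta_measure[of "\<lambda>_. 1" a b] nn_integral_beta_density[OF assms] by simp
qed

text \<open>Multiplying the density by \<open>1 - u\<close> yields a multiple of the density with
  parameters \<open>a\<close> and \<open>b + 1\<close>, which has mass 1. The recurrence of the Beta
  function gives the factor.\<close>

lemma nn_integral_beta_measure_one_minus:
  assumes "a > 0" "b > 0"
  shows "(\<integral>\<^sup>+u. ennreal (1 - u) \<partial>beta_measure a b) = ennreal (b / (a + b))"
proof -
  have B: "Beta a (b + 1) = b / (a + b) * Beta a b"
    using Beta_plus1_right[of b a] assms nonpos_Ints_nonpos[of b]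
    by (force simp: field_simps add_pos_pos)
  have *: "ennreal (beta_density a b u) * ennreal (1 - u) = ennreal (b / (a + b)) * ennreal (beta_density a (b + 1) u)" for u
  proof (cases "0 < u \<and> u < 1")
    case True
    have "(1 - u) powr b = (1 - u) powr (b - 1) * (1 - u)"
      using True powr_mult_base[of "1 - u" "b - 1"] by (simp add: mult.commute)
    then have "beta_density a b u * (1 - u) = b / (a + b) * beta_density a (b + 1) u"
      using assms True unfolding beta_density_def B by (simp add: mult_ac)
    then show ?thesis
      using True assms beta_density_nonneg[OF assms] by (simp flip: ennreal_mult')
  qed (simp add: beta_density_def)
  show ?thesis
    using nn_integral_beta_density[of a "b + 1"] assms
    by (subst nn_integral_beta_measure) (simp_all add: * nn_integral_cmult)
qed

lemma measure_beta_measure_Ioo: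
  assumes "a > 0" "b > 0"
  shows "measure (beta_measure a b) {0<..<1} = 1"
proof -
  have "emeasure (beta_measure a b) {0<..<1}
      = (\<integral>\<^sup>+u. ennreal (beta_density a b u) * indicator {0<..<1} u \<partial>lborel)"
    unfolding beta_measure_def by (rule emeasure_density) auto
  also have "\<dots> = (\<integral>\<^sup>+u. ennreal (beta_density a b u) \<partial>lborel)"
    by (intro nn_integral_cong) (auto simp: beta_density_def indicator_def)
  finally show ?thesis
    using nn_integral_beta_density[OF assms] by (simp add: measure_def)
qed

text \<open>\<open>A\<close> may leave the unit interval: the windows around target values 0 and 1
  do so.\<close>

lemma measure_beta_measure_pos:
  assumes "a > 0" "b > 0" and A: "A \<in> sets borel" and cd: "{c<..<d} \<subseteq> A" "0 \<le> c" "c < d" "d \<le> 1"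
  shows "measure (beta_measure a b) A > 0"
proof -
  interpret prob_space "beta_measure a b" by (rule prob_space_beta_measure) fact+
  have "emeasure (beta_measure a b) {c<..<d} \<noteq> 0"
  proof
    assume "emeasure (beta_measure a b) {c<..<d} = 0"
    then have "AE u in lborel. u \<in> {c<..<d} \<longrightarrow> beta_density a b u \<le> 0"
      unfolding beta_measure_def
      by (subst (asm) emeasure_density, simp, simp, subst (asm) nn_integral_0_iff_AE)
         (auto elim!: eventually_mono simp: indicator_def ennreal_eq_0_iff split: if_splits)
    moreover have "\<not> beta_density a b u \<le> 0" if "u \<in> {c<..<d}" for u
      using beta_density_pos[OF assms(1,2), of u] that cd by auto
    ultimately have "AE u in lborel. u \<notin> {c<..<d}"
      by (auto elim!: eventually_mono)
    then have "emeasure lborel {c<..<d} = 0"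
      by (subst (asm) AE_iff_measurable) auto
    then show False using cd by simp
  qed
  then have "measure (beta_measure a b) {c<..<d} > 0"
    by (simp add: emeasure_eq_measure zero_less_measure_iff)
  also have "\<dots> \<le> measure (beta_measure a b) A"
    using cd A by (intro finite_measure_mono) auto
  finally show ?thesis .
qed

subsection \<open>The quantile transform\<close>

lemma beta_cdf_mono: "a > 0 \<Longrightarrow> b > 0 \<Longrightarrow> x \<le> y \<Longrightarrow> beta_cdf a b x \<le> beta_cdf a b y"
  unfolding beta_cdf_def cdf_def
  by (intro finite_measure.finite_measure_mono prob_space.finite_measure prob_space_beta_measure) auto

lemma beta_cdf_range: "a > 0 \<Longrightarrow> b > 0 \<Longrightarrow> beta_cdf a b x \<in> {0..1}"
  using prob_space.prob_le_1[OF prob_space_beta_measure] by (auto simp: beta_cdf_def cdf_def)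

text \<open>A Beta law has no atoms, so its distribution function is continuous, and it runs from 0
  at 0 to 1 at 1. Surjectivity makes the \<open>inv_into\<close> in \<open>Ups\<close> a genuine
  right inverse.\<close>

lemma beta_cdf_surj:
  assumes "a > 0" "b > 0"
  shows "{0..1} \<subseteq> beta_cdf a b ` {0..1}"
proof
  fix y :: real assume y: "y \<in> {0..1}"
  interpret prob_space "beta_measure a b" by (rule prob_space_beta_measure) fact+
  interpret finite_borel_measure "beta_measure a b" by unfold_locales simp
  have "emeasure (beta_measure a b) {..0} = 0"
    unfolding beta_measure_def
    by (subst emeasure_density) (auto simp: beta_density_def indicator_def intro!: nn_integral_zero')
  then have F0: "beta_cdf a b 0 = 0"
    by (simp add: beta_cdf_def cdf_def measure_def)
  have "measure (beta_measure a b) {0<..<1} \<le> beta_cdf a b 1"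
    unfolding beta_cdf_def cdf_def by (intro finite_measure_mono) auto
  then have F1: "beta_cdf a b 1 = 1"
    using measure_beta_measure_Ioo[OF assms] beta_cdf_range[OF assms, of 1] by simp
  have "continuous (at x) (beta_cdf a b)" for x
  proof -
    have "emeasure (beta_measure a b) {x} = 0"
      unfolding beta_measure_def by (subst emeasure_density) (auto intro!: nn_integral_0_iff_AE[THEN iffD2] AE_I[of _ _ "{x}"] simp: indicator_def)
    then show ?thesis
      unfolding beta_cdf_def isCont_cdf by (simp add: measure_def)
  qed
  then have "\<exists>x. 0 \<le> x \<and> x \<le> 1 \<and> beta_cdf a b x = y"
    using y F0 F1 by (intro IVT') (auto intro: continuous_at_imp_continuous_on)
  then show "y \<in> beta_cdf a b ` {0..1}" by force
qed

context
  fixes \<alpha> \<beta> :: "nat \<Rightarrow> real"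
  assumes pos: "\<And>j. \<alpha> j > 0" "\<And>j. \<beta> j > 0"
begin

lemma Ups_range: "0 \<le> Ups \<alpha> \<beta> j x" "Ups \<alpha> \<beta> j x \<le> 1"
proof -
  have "Ups \<alpha> \<beta> j x \<in> {0..1}"
    unfolding Ups_def
    using beta_cdf_surj[OF pos[of "Suc j"]] beta_cdf_range[OF pos[of j], of x] by (intro inv_into_into) blast
  then show "0 \<le> Ups \<alpha> \<beta> j x" "Ups \<alpha> \<beta> j x \<le> 1" by auto
qed

text \<open>Only surjectivity of the second distribution function on the unit interval is used:
  any right inverse of a monotone function is monotone.\<close>
lemma mono_Ups: "mono (Ups \<alpha> \<beta> j)"
proof
  fix x y :: real assume "x \<le> y"
  let ?F = "beta_cdf (\<alpha> j) (\<beta> j)" and ?G = "beta_cdf (\<alpha> (Suc j)) (\<beta> (Suc j))"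
  have G: "?G (Ups \<alpha> \<beta> j z) = ?F z" for z
    unfolding Ups_def
    using beta_cdf_surj[OF pos[of "Suc j"]] beta_cdf_range[OF pos[of j], of z] by (intro f_inv_into_f) blast
  show "Ups \<alpha> \<beta> j x \<le> Ups \<alpha> \<beta> j y"
  \<comment> \<open>\<open>inv_into\<close> selects a preimage from the value alone, so equal values
    give equal results.\<close>
  proof (cases "?F x = ?F y")
    case False
    then have "?G (Ups \<alpha> \<beta> j x) < ?G (Ups \<alpha> \<beta> j y)"
      using beta_cdf_mono[OF pos \<open>x \<le> y\<close>, of j j] G by simp
    then show ?thesis
      using beta_cdf_mono[OF pos, of "Ups \<alpha> \<beta> j y" "Ups \<alpha> \<beta> j x" "Suc j" "Suc j"] by linarith
  qed (simp add: Ups_def)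
qed

lemma borel_measurable_Ups [measurable]: "Ups \<alpha> \<beta> j \<in> borel_measurable borel"
  by (rule borel_measurable_mono[OF mono_Ups])

end

subsection \<open>The stick-breaking Markov chain\<close>

text \<open>The state enters the kernel only through these weights, not through the Beta laws that
  they mix. This is what lets the integral over the next state factor out in
  \<open>nn_integral_chain\<close>.\<close>

definition binom_weight :: "nat \<Rightarrow> (nat \<Rightarrow> real) \<Rightarrow> (nat \<Rightarrow> real) \<Rightarrow> nat \<Rightarrow> real \<Rightarrow> nat \<Rightarrow> real" where
  "binom_weight N \<alpha> \<beta> j x z = real (N choose z) * Ups \<alpha> \<beta> j x ^ z * (1 - Ups \<alpha> \<beta> j x) ^ (N - z)"

lemma sum_binom_weight: "(\<Sum>z\<le>N. binom_weight N \<alpha> \<beta> j x z) = 1"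
  using binomial_ring[of "Ups \<alpha> \<beta> j x" "1 - Ups \<alpha> \<beta> j x" N] by (simp add: binom_weight_def)

lemma indicator_Ball_eq_prod:
  "finite I \<Longrightarrow> indicator {\<omega>. \<forall>i\<in>I. X i \<omega> \<in> A i} \<omega> = (\<Prod>i\<in>I. indicator (A i) (X i \<omega>) :: 'b::{comm_semiring_1})"
proof (induction I rule: finite_induct)
  case (insert k F)
  then have "(\<Prod>i\<in>insert k F. indicator (A i) (X i \<omega>) :: 'b)
      = indicator (A k) (X k \<omega>) * indicator {\<omega>. \<forall>i\<in>F. X i \<omega> \<in> A i} \<omega>"
    by simp
  then show ?case by (simp add: indicator_def)
qed simp

text \<open>The hypothesis says that \<open>X\<close> has the same law under the densities
  \<open>G\<close> and \<open>H\<close>, so it passes from indicators to all nonnegative Borel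
  functions of \<open>X\<close>.\<close>

lemma nn_integral_mult_eqI:
  assumes [measurable]: "X \<in> borel_measurable M" "G \<in> borel_measurable M" "H \<in> borel_measurable M"
    "f \<in> borel_measurable borel"
    and eq: "\<And>A. A \<in> sets borel \<Longrightarrow>
      (\<integral>\<^sup>+\<omega>. G \<omega> * indicator A (X \<omega>) \<partial>M) = (\<integral>\<^sup>+\<omega>. H \<omega> * indicator A (X \<omega>) \<partial>M)"
  shows "(\<integral>\<^sup>+\<omega>. G \<omega> * f (X \<omega>) \<partial>M) = (\<integral>\<^sup>+\<omega>. H \<omega> * f (X \<omega>) \<partial>M)"
proof -
  have *: "emeasure (distr (density M F) borel X) A = (\<integral>\<^sup>+\<omega>. F \<omega> * indicator A (X \<omega>) \<partial>M)"
    if "A \<in> sets borel" and [measurable]: "F \<in> borel_measurable M" for A F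
    using that(1) by (simp add: emeasure_distr emeasure_density indicator_vimage[symmetric])
      (auto intro!: nn_integral_cong simp: indicator_def)
  have "distr (density M G) borel X = distr (density M H) borel X"
    by (intro measure_eqI) (simp_all add: * eq)
  then have "(\<integral>\<^sup>+x. f x \<partial>distr (density M G) borel X) = (\<integral>\<^sup>+x. f x \<partial>distr (density M H) borel X)"
    by simp
  then show ?thesis
    by (simp add: nn_integral_distr nn_integral_density)
qed

locale beta_markov_chain = prob_space M for M :: "'w measure" +
  fixes N :: nat and \<alpha> \<beta> :: "nat \<Rightarrow> real" and v :: "nat \<Rightarrow> 'w \<Rightarrow> real"
  assumes pos: "\<And>j. \<alpha> j > 0" "\<And>j. \<beta> j > 0"
    and chain: "bmsb_chain M N \<alpha> \<beta> v"
begin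

abbreviation "trans_beta j z \<equiv> beta_measure (\<alpha> (Suc j) + real z) (\<beta> (Suc j) + real (N - z))"

lemma trans_param_pos: "\<alpha> (Suc j) + real z > 0" "\<beta> (Suc j) + real (N - z) > 0"
  using pos[of "Suc j"] by (auto intro: add_pos_nonneg)

lemma v_measurable [measurable]: "v j \<in> borel_measurable M"
  using chain by (auto simp: bmsb_chain_def)

lemma binom_weight_nonneg: "0 \<le> binom_weight N \<alpha> \<beta> j x z"
  using Ups_range[of \<alpha> \<beta> j x] pos by (auto simp: binom_weight_def)

lemma measurable_binom_weight [measurable]: "(\<lambda>x. binom_weight N \<alpha> \<beta> j x z) \<in> borel_measurable borel"
  using borel_measurable_Ups[of \<alpha> \<beta> j, OF pos] unfolding binom_weight_def by measurable

lemma kernel_eq: "bmsb_kernel N \<alpha> \<beta> j x A = (\<Sum>z\<le>N. binom_weight N \<alpha> \<beta> j x z * measure (trans_beta j z) A)"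
  by (simp add: bmsb_kernel_def binom_weight_def)

lemma measurable_kernel [measurable]: "(\<lambda>x. bmsb_kernel N \<alpha> \<beta> j x A) \<in> borel_measurable borel"
  unfolding kernel_eq by measurable

text \<open>The kernel is a convex combination of the component laws, so a bound shared by all
  components survives the mixing, uniformly in the state \<open>x\<close>.\<close>

lemma kernel_le:
  assumes "\<And>z. z \<le> N \<Longrightarrow> measure (trans_beta j z) A \<le> c"
  shows "bmsb_kernel N \<alpha> \<beta> j x A \<le> c"
proof -
  have "bmsb_kernel N \<alpha> \<beta> j x A \<le> (\<Sum>z\<le>N. binom_weight N \<alpha> \<beta> j x z * c)"
    unfolding kernel_eq using assms by (intro sum_mono mult_left_mono binom_weight_nonneg) auto
  then show ?thesis by (simp add: sum_distrib_right[symmetric] sum_binom_weight)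
qed

lemma kernel_ge:
  assumes "\<And>z. z \<le> N \<Longrightarrow> c \<le> measure (trans_beta j z) A"
  shows "c \<le> bmsb_kernel N \<alpha> \<beta> j x A"
proof -
  have "(\<Sum>z\<le>N. binom_weight N \<alpha> \<beta> j x z * c) \<le> bmsb_kernel N \<alpha> \<beta> j x A"
    unfolding kernel_eq using assms by (intro sum_mono mult_left_mono binom_weight_nonneg) auto
  then show ?thesis by (simp add: sum_distrib_right[symmetric] sum_binom_weight)
qed

lemma kernel_range: "0 \<le> bmsb_kernel N \<alpha> \<beta> j x A" "bmsb_kernel N \<alpha> \<beta> j x A \<le> 1"
  by (auto intro!: kernel_ge kernel_le prob_space.prob_le_1 prob_space_beta_measure trans_param_pos)

lemma ennreal_kernel:
  "ennreal (bmsb_kernel N \<alpha> \<beta> j x A)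
     = (\<Sum>z\<le>N. ennreal (binom_weight N \<alpha> \<beta> j x z) * emeasure (trans_beta j z) A)"
proof -
  have "finite_measure (trans_beta j z)" for z
    by (intro prob_space.finite_measure prob_space_beta_measure trans_param_pos)
  then show ?thesis
    unfolding kernel_eq
    by (subst sum_ennreal[symmetric])
       (auto simp: ennreal_mult binom_weight_nonneg finite_measure.emeasure_eq_measure simp del: of_nat_diff intro!: mult_nonneg_nonneg)
qed

lemma emeasure_chain:
  assumes [measurable]: "\<And>i. A i \<in> sets borel"
  shows "emeasure M {\<omega> \<in> space M. \<forall>i\<le>Suc n. v i \<omega> \<in> A i}
       = (\<integral>\<^sup>+\<omega>. indicator {\<omega>. \<forall>i\<le>n. v i \<omega> \<in> A i} \<omega> * ennreal (bmsb_kernel N \<alpha> \<beta> n (v n \<omega>) (A (Suc n))) \<partial>M)"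
proof -
  have *: "ennreal (indicator S \<omega> * k) = indicator S \<omega> * ennreal k" for S and \<omega> :: 'w and k
    by (cases "\<omega> \<in> S") auto
  have "measure M {\<omega> \<in> space M. \<forall>i\<le>Suc n. v i \<omega> \<in> A i} =
        (\<integral>\<omega>. indicator {\<omega>. \<forall>i\<le>n. v i \<omega> \<in> A i} \<omega> * bmsb_kernel N \<alpha> \<beta> n (v n \<omega>) (A (Suc n)) \<partial>M)"
    using chain assms by (auto simp: bmsb_chain_def)
  then have "emeasure M {\<omega> \<in> space M. \<forall>i\<le>Suc n. v i \<omega> \<in> A i}
    = ennreal (\<integral>\<omega>. indicator {\<omega>. \<forall>i\<le>n. v i \<omega> \<in> A i} \<omega> * bmsb_kernel N \<alpha> \<beta> n (v n \<omega>) (A (Suc n)) \<partial>M)"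
    by (simp only: emeasure_eq_measure)
  also have "\<dots> = (\<integral>\<^sup>+\<omega>. ennreal (indicator {\<omega>. \<forall>i\<le>n. v i \<omega> \<in> A i} \<omega> * bmsb_kernel N \<alpha> \<beta> n (v n \<omega>) (A (Suc n))) \<partial>M)"
  proof (rule nn_integral_eq_integral[symmetric])
    show "integrable M (\<lambda>\<omega>. indicator {\<omega>. \<forall>i\<le>n. v i \<omega> \<in> A i} \<omega> * bmsb_kernel N \<alpha> \<beta> n (v n \<omega>) (A (Suc n)))"
      by (intro integrable_const_bound[of _ 1]) (auto simp: indicator_def kernel_range abs_of_nonneg)
  qed (auto simp: kernel_range)
  also have "\<dots> = (\<integral>\<^sup>+\<omega>. indicator {\<omega>. \<forall>i\<le>n. v i \<omega> \<in> A i} \<omega> * ennreal (bmsb_kernel N \<alpha> \<beta> n (v n \<omega>) (A (Suc n))) \<partial>M)"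
    by (simp only: *)
  finally show ?thesis .
qed

text \<open>Products of functions of single coordinates are all that is required later: the
  remaining stick length has exactly this form.\<close>

lemma nn_integral_chain_indicator:
  assumes [measurable]: "\<And>i. h i \<in> borel_measurable borel" "B \<in> sets borel"
  shows "(\<integral>\<^sup>+\<omega>. (\<Prod>i\<le>n. h i (v i \<omega>)) * indicator B (v (Suc n) \<omega>) \<partial>M)
       = (\<integral>\<^sup>+\<omega>. (\<Prod>i\<le>n. h i (v i \<omega>)) * ennreal (bmsb_kernel N \<alpha> \<beta> n (v n \<omega>) B) \<partial>M)"
proof -
  have "(\<integral>\<^sup>+\<omega>. (\<Prod>i\<le>n. h i (v i \<omega>)) * indicator B (v (Suc n) \<omega>) \<partial>M)
       = (\<integral>\<^sup>+\<omega>. (\<Prod>i\<le>n. h i (v i \<omega>)) * ennreal (bmsb_kernel N \<alpha> \<beta> n (v n \<omega>) B) \<partial>M)"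
    if "\<And>i. h i \<in> borel_measurable borel" "\<And>i. i \<ge> k \<Longrightarrow> i \<le> n \<Longrightarrow> \<exists>A\<in>sets borel. h i = indicator A" for h :: "nat \<Rightarrow> real \<Rightarrow> ennreal" and k
    using that
    \<comment> \<open>The first k factors are arbitrary, the remaining ones are indicators; one indicator at a time is
      replaced by an arbitrary function, by comparing the laws of \<open>v k\<close> under two densities.\<close>
  proof (induction k arbitrary: h)
    case 0
    then obtain A where A: "\<And>i. i \<le> n \<Longrightarrow> A i \<in> sets borel" "\<And>i. i \<le> n \<Longrightarrow> h i = indicator (A i)"
      by (metis zero_le)
    \<comment> \<open>The chain condition speaks of a whole sequence of Borel sets; this extension
      puts \<open>B\<close> at index \<open>Suc n\<close>.\<close>
    define A' where "A' i = (if i \<le> n then A i else B)" for i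
    have A' [measurable]: "A' i \<in> sets borel" for i using A by (auto simp: A'_def)
    have h: "(\<Prod>i\<le>n. h i (v i \<omega>)) = indicator {\<omega>. \<forall>i\<le>n. v i \<omega> \<in> A' i} \<omega>" for \<omega>
    proof -
      have "(\<Prod>i\<le>n. h i (v i \<omega>)) = (\<Prod>i\<le>n. indicator (A' i) (v i \<omega>))"
        using A(2) by (intro prod.cong) (auto simp: A'_def)
      also have "\<dots> = indicator {\<omega>. \<forall>i\<in>{..n}. v i \<omega> \<in> A' i} \<omega>"
        by (rule indicator_Ball_eq_prod[symmetric]) simp
      finally show ?thesis by (simp add: Ball_def)
    qed
    have "emeasure M {\<omega> \<in> space M. \<forall>i\<le>Suc n. v i \<omega> \<in> A' i}
        = (\<integral>\<^sup>+\<omega>. indicator {\<omega> \<in> space M. \<forall>i\<le>Suc n. v i \<omega> \<in> A' i} \<omega> \<partial>M)"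
      by (rule nn_integral_indicator[symmetric]) measurable
    also have "\<dots> = (\<integral>\<^sup>+\<omega>. (\<Prod>i\<le>n. h i (v i \<omega>)) * indicator B (v (Suc n) \<omega>) \<partial>M)"
      unfolding h by (intro nn_integral_cong) (auto simp: indicator_def A'_def le_Suc_eq)
    finally show ?case
      unfolding h using emeasure_chain[OF A', of n] by (simp add: A'_def)
  next
    case (Suc k)
    note Suc.prems(1)[measurable]
    show ?case
    proof (cases "k \<le> n")
      case False
      then show ?thesis using Suc.prems by (intro Suc.IH) auto
    next
      case True
      define G where "G \<omega> = (\<Prod>i\<in>{..n} - {k}. h i (v i \<omega>))" for \<omega>
      have [measurable]: "G \<in> borel_measurable M" unfolding G_def by measurable
      have split: "(\<Prod>i\<le>n. (h(k := f)) i (v i \<omega>)) = G \<omega> * f (v k \<omega>)" for f \<omega>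
        using True by (subst prod.remove[of _ k]) (auto simp: G_def mult.commute)
      have "(\<integral>\<^sup>+\<omega>. (G \<omega> * indicator B (v (Suc n) \<omega>)) * h k (v k \<omega>) \<partial>M)
          = (\<integral>\<^sup>+\<omega>. (G \<omega> * ennreal (bmsb_kernel N \<alpha> \<beta> n (v n \<omega>) B)) * h k (v k \<omega>) \<partial>M)"
      proof (rule nn_integral_mult_eqI[where X = "v k" and f = "h k"])
        fix A :: "real set" assume "A \<in> sets borel"
        then have "(\<integral>\<^sup>+\<omega>. (\<Prod>i\<le>n. (h(k := indicator A)) i (v i \<omega>)) * indicator B (v (Suc n) \<omega>) \<partial>M)
           = (\<integral>\<^sup>+\<omega>. (\<Prod>i\<le>n. (h(k := indicator A)) i (v i \<omega>)) * ennreal (bmsb_kernel N \<alpha> \<beta> n (v n \<omega>) B) \<partial>M)"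
          using Suc.prems by (intro Suc.IH) auto
        then show "(\<integral>\<^sup>+\<omega>. (G \<omega> * indicator B (v (Suc n) \<omega>)) * indicator A (v k \<omega>) \<partial>M)
          = (\<integral>\<^sup>+\<omega>. (G \<omega> * ennreal (bmsb_kernel N \<alpha> \<beta> n (v n \<omega>) B)) * indicator A (v k \<omega>) \<partial>M)"
          unfolding split by (simp add: mult_ac)
      qed measurable
      moreover have "(\<Prod>i\<le>n. h i (v i \<omega>)) = G \<omega> * h k (v k \<omega>)" for \<omega>
        using split[of "h k" \<omega>] by simp
      ultimately show ?thesis by (simp add: mult_ac)
    qed
  qed
  note * = this
  \<comment> \<open>With \<open>Suc n\<close> for k, no index of the product is required to carry an
    indicator.\<close>
  show ?thesis
    by (rule *[OF assms(1), of "Suc n"]) linarith+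
qed

text \<open>Weighted by the past factors, the law of the next state is a mixture of the Beta laws
  with constant coefficients. Knowing it on Borel sets determines its integral of any
  \<open>f\<close>.\<close>

lemma nn_integral_chain:
  assumes [measurable]: "\<And>i. h i \<in> borel_measurable borel" "f \<in> borel_measurable borel"
  shows "(\<integral>\<^sup>+\<omega>. (\<Prod>i\<le>n. h i (v i \<omega>)) * f (v (Suc n) \<omega>) \<partial>M)
       = (\<Sum>z\<le>N. (\<integral>\<^sup>+\<omega>. (\<Prod>i\<le>n. h i (v i \<omega>)) * ennreal (binom_weight N \<alpha> \<beta> n (v n \<omega>) z) \<partial>M)
            * (\<integral>\<^sup>+u. f u \<partial>trans_beta n z))"
proof -
  define c where "c z = (\<integral>\<^sup>+\<omega>. (\<Prod>i\<le>n. h i (v i \<omega>)) * ennreal (binom_weight N \<alpha> \<beta> n (v n \<omega>) z) \<partial>M)" for z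
  define d where "d z = (\<lambda>u. ennreal (beta_density (\<alpha> (Suc n) + real z) (\<beta> (Suc n) + real (N - z)) u))" for z
  have [measurable]: "d z \<in> borel_measurable borel" for z unfolding d_def by measurable
  define \<nu> where "\<nu> = distr (density M (\<lambda>\<omega>. \<Prod>i\<le>n. h i (v i \<omega>))) borel (v (Suc n))"
  \<comment> \<open>All components have Lebesgue densities, so the mixture is written as one density
    instead of a sum of measures.\<close>
  define \<mu> where "\<mu> = density lborel (\<lambda>u. \<Sum>z\<le>N. c z * d z u)"
  have nn\<mu>: "(\<integral>\<^sup>+u. g u \<partial>\<mu>) = (\<Sum>z\<le>N. c z * (\<integral>\<^sup>+u. g u \<partial>trans_beta n z))"
    if [measurable]: "g \<in> borel_measurable borel" for g
  proof -
    have "(\<integral>\<^sup>+u. g u \<partial>\<mu>) = (\<integral>\<^sup>+u. (\<Sum>z\<le>N. c z * (d z u * g u)) \<partial>lborel)"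
      unfolding \<mu>_def by (subst nn_integral_density) (auto simp: sum_distrib_right mult.assoc)
    also have "\<dots> = (\<Sum>z\<le>N. c z * (\<integral>\<^sup>+u. d z u * g u \<partial>lborel))"
      by (subst nn_integral_sum) (auto simp: nn_integral_cmult)
    finally show ?thesis by (simp add: nn_integral_beta_measure d_def)
  qed
  have "\<nu> = \<mu>"
  proof (rule measure_eqI)
    show "sets \<nu> = sets \<mu>" by (simp add: \<nu>_def \<mu>_def)
    fix B assume "B \<in> sets \<nu>"
    then have [measurable]: "B \<in> sets borel" by (simp add: \<nu>_def)
    have "emeasure \<nu> B = (\<integral>\<^sup>+u. indicator B u \<partial>\<nu>)"
      by (rule nn_integral_indicator[symmetric]) (simp add: \<nu>_def)
    also have "\<dots> = (\<integral>\<^sup>+\<omega>. (\<Prod>i\<le>n. h i (v i \<omega>)) * indicator B (v (Suc n) \<omega>) \<partial>M)"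
      unfolding \<nu>_def by (subst nn_integral_distr, measurable, subst nn_integral_density) auto
    also have "\<dots> = (\<integral>\<^sup>+\<omega>. (\<Sum>z\<le>N. (\<Prod>i\<le>n. h i (v i \<omega>)) * ennreal (binom_weight N \<alpha> \<beta> n (v n \<omega>) z) * emeasure (trans_beta n z) B) \<partial>M)"
      by (subst nn_integral_chain_indicator) (auto simp: ennreal_kernel sum_distrib_left mult.assoc)
    also have "\<dots> = (\<Sum>z\<le>N. c z * emeasure (trans_beta n z) B)"
      unfolding c_def by (subst nn_integral_sum) (auto simp: nn_integral_multc)
    also have "\<dots> = (\<integral>\<^sup>+u. indicator B u \<partial>\<mu>)"
      by (simp add: nn\<mu>)
    also have "\<dots> = emeasure \<mu> B"
      by (rule nn_integral_indicator) (simp add: \<mu>_def)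
    finally show "emeasure \<nu> B = emeasure \<mu> B" .
  qed
  have "(\<integral>\<^sup>+\<omega>. (\<Prod>i\<le>n. h i (v i \<omega>)) * f (v (Suc n) \<omega>) \<partial>M) = (\<integral>\<^sup>+u. f u \<partial>\<nu>)"
    unfolding \<nu>_def by (subst nn_integral_distr, measurable, subst nn_integral_density) auto
  then show ?thesis
    unfolding \<open>\<nu> = \<mu>\<close> using nn\<mu>[of f] by (simp add: c_def)
qed

lemma AE_v_Ioo: "AE \<omega> in M. v j \<omega> \<in> {0<..<1}"
proof (cases j)
  case 0
  have "prob (v 0 -` {0<..<1} \<inter> space M) = measure (distr M borel (v 0)) {0<..<1}"
    by (simp add: measure_distr)
  also have "\<dots> = 1"
    using chain pos by (simp add: bmsb_chain_def measure_beta_measure_Ioo)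
  finally show ?thesis
    using prob_eq_1[of "v 0 -` {0<..<1} \<inter> space M"] 0 by (auto elim!: eventually_mono)
next
  case (Suc n)
  \<comment> \<open>A rectangle that constrains only the last coordinate; the kernel gives that
    constraint probability 1 from every state.\<close>
  define A where "A i = (if i \<le> n then UNIV else {0<..<1::real})" for i
  have "bmsb_kernel N \<alpha> \<beta> n x (A (Suc n)) = 1" for x
    by (simp add: A_def kernel_eq del: of_nat_diff add: measure_beta_measure_Ioo trans_param_pos sum_binom_weight)
  moreover have A: "A i \<in> sets borel" for i by (simp add: A_def)
  ultimately have "emeasure M {\<omega> \<in> space M. \<forall>i\<le>Suc n. v i \<omega> \<in> A i} = 1"
    using emeasure_chain[of A n] emeasure_space_1 by (simp add: A_def)
  then have "prob {\<omega> \<in> space M. \<forall>i\<le>Suc n. v i \<omega> \<in> A i} = 1"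
    by (simp add: measure_def)
  then have "AE \<omega> in M. \<omega> \<in> {\<omega> \<in> space M. \<forall>i\<le>Suc n. v i \<omega> \<in> A i}"
    by (intro AE_prob_1)
  then show ?thesis
    unfolding Suc by (rule eventually_mono) (auto simp: A_def)
qed

lemma prob_chain_pos:
  assumes [measurable]: "\<And>i. A i \<in> sets borel"
    and cd: "\<And>i. \<exists>c d. {c<..<d} \<subseteq> A i \<and> 0 \<le> c \<and> c < d \<and> d \<le> 1"
  shows "prob {\<omega> \<in> space M. \<forall>i\<le>n. v i \<omega> \<in> A i} > 0"
proof (induction n)
  case 0
  have "prob {\<omega> \<in> space M. v 0 \<omega> \<in> A 0} = measure (distr M borel (v 0)) (A 0)"
    by (simp add: measure_distr vimage_def Int_def conj_commute)
  also have "\<dots> > 0"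
    using chain cd[of 0] pos by (auto simp: bmsb_chain_def intro: measure_beta_measure_pos)
  finally show ?case by simp
next
  case (Suc n)
  \<comment> \<open>A minimum over finitely many components is positive and bounds the kernel below
    from every state, so extending the path by one step costs at most the factor
    \<open>m\<close>.\<close>
  define m where "m = Min ((\<lambda>z. measure (trans_beta n z) (A (Suc n))) ` {..N})"
  have "m > 0"
    unfolding m_def using cd[of "Suc n"] trans_param_pos by (auto simp del: of_nat_diff intro: measure_beta_measure_pos)
  have "m \<le> bmsb_kernel N \<alpha> \<beta> n x (A (Suc n))" for x
    unfolding m_def by (intro kernel_ge) auto
  have "0 < emeasure M {\<omega> \<in> space M. \<forall>i\<le>n. v i \<omega> \<in> A i} * ennreal m"
    using Suc \<open>m > 0\<close> by (simp add: emeasure_eq_measure ennreal_zero_less_mult_iff)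
  also have "\<dots> = (\<integral>\<^sup>+\<omega>. indicator {\<omega> \<in> space M. \<forall>i\<le>n. v i \<omega> \<in> A i} \<omega> * ennreal m \<partial>M)"
    by (subst nn_integral_multc) auto
  also have "\<dots> \<le> emeasure M {\<omega> \<in> space M. \<forall>i\<le>Suc n. v i \<omega> \<in> A i}"
    unfolding emeasure_chain[OF assms(1)]
    by (intro nn_integral_mono mult_mono ennreal_leI \<open>\<And>x. m \<le> _ x _\<close>) (auto simp: indicator_def)
  finally show ?case by (simp add: emeasure_eq_measure)
qed

lemma AE_v_all: "AE \<omega> in M. \<forall>j. v j \<omega> \<in> {0<..<1}"
  using AE_v_Ioo by (simp add: AE_all_countable)

end

subsection \<open>Properness\<close>

lemma sum_stick_weight: "(\<Sum>j<n. stick_weight v j \<omega>) = 1 - (\<Prod>i<n. 1 - v i \<omega>)"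
  by (induction n) (auto simp: stick_weight_def algebra_simps)

text \<open>Since \<open>1 - q i\<close> is at most \<open>exp (- q i)\<close>, a positive lower
  bound on the products would bound the partial sums of \<open>q\<close>.\<close>

lemma prod_one_minus_arbitrarily_small:
  fixes q :: "nat \<Rightarrow> real"
  assumes q: "\<And>i. 0 \<le> q i" "\<And>i. q i \<le> 1" and "\<not> summable q" and "e > 0"
  shows "\<exists>n. (\<Prod>i<n. 1 - q i) < e"
proof (rule ccontr)
  assume "\<not> ?thesis"
  then have ge: "e \<le> (\<Prod>i<n. 1 - q i)" for n by (simp add: not_less)
  have "sum q {..<n} \<le> 1 / e" for n
  proof -
    have "e \<le> (\<Prod>i<n. 1 - q i)" by (rule ge)
    also have "\<dots> \<le> (\<Prod>i<n. exp (- q i))"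
      using q exp_ge_add_one_self[of "- q _"] by (intro prod_mono) auto
    also have "\<dots> = exp (\<Sum>i<n. - q i)"
      by (rule exp_sum[symmetric]) simp
    also have "\<dots> = inverse (exp (sum q {..<n}))"
      by (simp add: sum_negf exp_minus)
    finally have "exp (sum q {..<n}) \<le> 1 / e"
      using \<open>e > 0\<close> by (simp add: field_simps)
    \<comment> \<open>The inequality \<open>1 + s \<le> exp s\<close> replaces taking a logarithm;
      the crude bound \<open>1 / e\<close> is enough.\<close>
    then show ?thesis using exp_ge_add_one_self[of "sum q {..<n}"] by linarith
  qed
  then have "summable q" by (intro summableI_nonneg_bounded q)
  with assms show False by simp
qed

context beta_markov_chain
begin

lemma AE_stick_weight_pos: "AE \<omega> in M. stick_weight v j \<omega> > 0"
  using AE_v_all by (rule eventually_mono) (auto simp: stick_weight_def intro!: mult_pos_pos prod_pos)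

text \<open>The factor of \<open>v 0\<close> is bounded by 1, so the right side counts only the n
  transitions. Component z has mean \<open>(\<beta> (Suc n) + N - z) / (\<alpha> (Suc n) + \<beta>
  (Suc n) + N)\<close> for \<open>1 - u\<close>, which is largest at \<open>z = 0\<close>.\<close>

lemma nn_integral_prod_one_minus_le:
  "(\<integral>\<^sup>+\<omega>. (\<Prod>i\<le>n. ennreal (1 - v i \<omega>)) \<partial>M)
     \<le> ennreal (\<Prod>i<n. 1 - \<alpha> (Suc i) / (\<alpha> (Suc i) + \<beta> (Suc i) + N))"
proof (induction n)
  case 0
  have "(\<integral>\<^sup>+\<omega>. ennreal (1 - v 0 \<omega>) \<partial>M) \<le> (\<integral>\<^sup>+\<omega>. 1 \<partial>M)"
    using AE_v_Ioo[of 0] by (intro nn_integral_mono_AE) (auto elim!: eventually_mono)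
  then show ?case by (simp add: emeasure_space_1)
next
  case (Suc n)
  define R where "R \<omega> = (\<Prod>i\<le>n. ennreal (1 - v i \<omega>))" for \<omega>
  have [measurable]: "R \<in> borel_measurable M" unfolding R_def by measurable
  define c where "c z = (\<integral>\<^sup>+\<omega>. R \<omega> * ennreal (binom_weight N \<alpha> \<beta> n (v n \<omega>) z) \<partial>M)" for z
  define r where "r = 1 - \<alpha> (Suc n) / (\<alpha> (Suc n) + \<beta> (Suc n) + N)"
  have r: "r = (\<beta> (Suc n) + N) / (\<alpha> (Suc n) + \<beta> (Suc n) + N)"
    using pos[of "Suc n"] by (simp add: r_def field_simps add_pos_nonneg)
  have "r \<ge> 0"
    unfolding r using pos[of "Suc n"] by simp
  have "(\<integral>\<^sup>+\<omega>. (\<Prod>i\<le>Suc n. ennreal (1 - v i \<omega>)) \<partial>M) = (\<Sum>z\<le>N. c z * (\<integral>\<^sup>+u. ennreal (1 - u) \<partial>trans_beta n z))"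
    using nn_integral_chain[of "\<lambda>_ u. ennreal (1 - u)" "\<lambda>u. ennreal (1 - u)" n]
    by (simp add: c_def R_def)
  also have "\<dots> \<le> (\<Sum>z\<le>N. c z * ennreal r)"
  proof (intro sum_mono mult_left_mono)
    fix z assume "z \<in> {..N}"
    then show "(\<integral>\<^sup>+u. ennreal (1 - u) \<partial>trans_beta n z) \<le> ennreal r"
      unfolding nn_integral_beta_measure_one_minus[OF trans_param_pos] r
      using pos[of "Suc n"] by (intro ennreal_leI frac_le) auto
  qed simp
  also have "\<dots> = (\<Sum>z\<le>N. c z) * ennreal r"
    by (simp add: sum_distrib_right)
  \<comment> \<open>The binomial weights sum to 1 in every state, so the coefficients add up to the
    integral of \<open>R\<close> and the induction hypothesis applies.\<close>
  also have "(\<Sum>z\<le>N. c z) = (\<integral>\<^sup>+\<omega>. R \<omega> * (\<Sum>z\<le>N. ennreal (binom_weight N \<alpha> \<beta> n (v n \<omega>) z)) \<partial>M)"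
    unfolding c_def by (subst nn_integral_sum[symmetric]) (auto simp: sum_distrib_left)
  also have "\<dots> = (\<integral>\<^sup>+\<omega>. R \<omega> \<partial>M)"
    by (simp add: binom_weight_nonneg sum_binom_weight)
  also have "\<dots> * ennreal r \<le> ennreal (\<Prod>i<n. 1 - \<alpha> (Suc i) / (\<alpha> (Suc i) + \<beta> (Suc i) + N)) * ennreal r"
    using Suc by (intro mult_right_mono) (auto simp: R_def)
  also have "\<dots> = ennreal (\<Prod>i<Suc n. 1 - \<alpha> (Suc i) / (\<alpha> (Suc i) + \<beta> (Suc i) + N))"
    using \<open>r \<ge> 0\<close> by (simp add: ennreal_mult'' r_def)
  finally show ?case .
qed

lemma AE_sum_stick_weight_eq_1:
  assumes div: "\<not> summable (\<lambda>j. \<alpha> j / (\<alpha> j + \<beta> j))"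
    and lim: "limsup (\<lambda>j. ereal (1 / (\<alpha> j + \<beta> j))) < \<infinity>"
  shows "AE \<omega> in M. (\<Sum>j. stick_weight v j \<omega>) = 1"
proof -
  define q where "q i = \<alpha> i / (\<alpha> i + \<beta> i + N)" for i
  have q: "0 \<le> q i" "q i \<le> 1" for i
    using pos[of i] by (auto simp: q_def)
  obtain C :: real where C: "limsup (\<lambda>j. ereal (1 / (\<alpha> j + \<beta> j))) < ereal C"
    using ereal_dense2[OF lim] by auto
  have "\<not> summable q"
  proof
    assume "summable q"
    \<comment> \<open>Eventually \<open>1 \<le> C * s\<close> for
      \<open>s = \<alpha> j + \<beta> j\<close>, hence \<open>s + N \<le> (1 + N * C) * s\<close>.
      This is the factor by which the given terms can exceed \<open>q j\<close>.\<close>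
    then have "summable (\<lambda>j. (1 + real N * C) * q j)" by (rule summable_mult)
    moreover have "eventually (\<lambda>j. norm (\<alpha> j / (\<alpha> j + \<beta> j)) \<le> (1 + real N * C) * q j) sequentially"
      using Limsup_lessD[OF C]
    proof eventually_elim
      case (elim j)
      define s where "s = \<alpha> j + \<beta> j"
      have "s > 0" using pos[of j] by (simp add: s_def)
      with elim have "1 \<le> C * s" by (simp add: s_def field_simps)
      then have "real N \<le> real N * (C * s)"
        using mult_left_mono[of 1 "C * s" "real N"] by simp
      then have "1 / s \<le> (1 + real N * C) / (s + N)"
        using \<open>s > 0\<close> by (simp add: field_simps)
      then have "\<alpha> j * (1 / s) \<le> \<alpha> j * ((1 + real N * C) / (s + N))"
        using pos[of j] by (intro mult_left_mono) auto
      then show ?case using pos[of j] by (simp add: q_def s_def mult.commute)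
    qed
    ultimately have "summable (\<lambda>j. \<alpha> j / (\<alpha> j + \<beta> j))"
      by (rule summable_comparison_test_ev[rotated])
    with div show False ..
  qed
  then have nsum: "\<not> summable (\<lambda>i. q (Suc i))" by (simp add: summable_Suc_iff)
  \<comment> \<open>The integral of the infimum lies below every expected remaining length and is
    therefore 0; a nonnegative function with integral 0 vanishes almost everywhere.\<close>
  define D where "D = (\<integral>\<^sup>+\<omega>. (INF n. \<Prod>i\<le>n. ennreal (1 - v i \<omega>)) \<partial>M)"
  have D_le: "D \<le> ennreal e" if "e > 0" for e
  proof -
    obtain n where n: "(\<Prod>i<n. 1 - q (Suc i)) < e"
      using prod_one_minus_arbitrarily_small[OF q nsum \<open>e > 0\<close>] by auto
    have "D \<le> (\<integral>\<^sup>+\<omega>. (\<Prod>i\<le>n. ennreal (1 - v i \<omega>)) \<partial>M)"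
      unfolding D_def by (intro nn_integral_mono INF_lower) simp
    also have "\<dots> \<le> ennreal (\<Prod>i<n. 1 - q (Suc i))"
      unfolding q_def by (rule nn_integral_prod_one_minus_le)
    also have "\<dots> \<le> ennreal e" using n by (intro ennreal_leI) simp
    finally show ?thesis .
  qed
  have "D \<le> 0"
    by (rule ennreal_le_epsilon) (simp add: D_le)
  then have "AE \<omega> in M. (INF n. \<Prod>i\<le>n. ennreal (1 - v i \<omega>)) = 0"
    unfolding D_def by (subst (asm) le_zero_eq, subst (asm) nn_integral_0_iff_AE) auto
  with AE_v_all show ?thesis
  proof eventually_elim
    case (elim \<omega>)
    define R where "R n = (\<Prod>i<n. 1 - v i \<omega>)" for n
    have v01: "0 \<le> 1 - v i \<omega>" "1 - v i \<omega> \<le> 1" for i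
      using elim(1) by (auto intro: less_imp_le simp: less_eq_real_def)
    have R_nonneg: "0 \<le> R n" for n unfolding R_def by (intro prod_nonneg v01 ballI)
    have "decseq R"
      using R_nonneg v01 by (intro decseq_SucI) (auto simp: R_def mult_left_le)
    have "R \<longlonglongrightarrow> 0"
    proof (rule LIMSEQ_I)
      fix e :: real assume "e > 0"
      then have "(INF n. \<Prod>i\<le>n. ennreal (1 - v i \<omega>)) < ennreal e" using elim by simp
      then obtain n where "(\<Prod>i\<le>n. ennreal (1 - v i \<omega>)) < ennreal e" by (auto simp: INF_less_iff)
      then have "ennreal (R (Suc n)) < ennreal e"
        by (simp only: prod_ennreal v01 R_def lessThan_Suc_atMost)
      then have "R (Suc n) < e" using R_nonneg by (simp add: ennreal_less_iff)
      then have "norm (R k - 0) < e" if "k \<ge> Suc n" for k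
        using decseqD[OF \<open>decseq R\<close> that] R_nonneg[of k] by simp
      then show "\<exists>no. \<forall>k\<ge>no. norm (R k - 0) < e" by blast
    qed
    then have "(\<lambda>n. 1 - R n) \<longlonglongrightarrow> 1 - 0" by (intro tendsto_intros)
    then have "(\<lambda>j. stick_weight v j \<omega>) sums 1"
      by (simp add: sums_def sum_stick_weight R_def)
    then show ?case by (rule sums_unique[symmetric])
  qed
qed

end

subsection \<open>Finitely supported approximation in the weak topology\<close>

text \<open>Carries the setwise definition of the random measure, an atomic part plus a multiple of
  \<open>P0\<close>, over to integrals.\<close>

lemma nn_integral_add_scaled_measure:
  fixes f :: "'a \<Rightarrow> ennreal"
  assumes sets: "sets B = sets A" "sets S = sets A"
    and S: "\<And>X. X \<in> sets A \<Longrightarrow> emeasure S X = emeasure A X + c * emeasure B X"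
    and f: "f \<in> borel_measurable A"
  shows "(\<integral>\<^sup>+x. f x \<partial>S) = (\<integral>\<^sup>+x. f x \<partial>A) + c * (\<integral>\<^sup>+x. f x \<partial>B)"
proof -
  note [measurable_cong] = sets
  have sp: "space B = space A" "space S = space A"
    by (rule sets(1)[THEN sets_eq_imp_space_eq], rule sets(2)[THEN sets_eq_imp_space_eq])
  show ?thesis
    using f
  proof (induction rule: borel_measurable_induct)
    case (cong f g)
    have "(\<integral>\<^sup>+x. f x \<partial>K) = (\<integral>\<^sup>+x. g x \<partial>K)" if "space K = space A" for K
      using cong(3) that by (intro nn_integral_cong) simp
    with cong(4) sp show ?case by simp
  next
    case (set X)
    then show ?case by (simp add: sets S)
  next
    case (mult u k)
    note [measurable] = mult(2)
    show ?case by (simp add: nn_integral_cmult mult distrib_left mult_ac)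
  next
    case (add u w)
    note [measurable] = add(1,3)
    show ?case by (simp add: nn_integral_add add distrib_left add_ac)
  next
    case (seq U)
    note [measurable] = seq(1)
    have inc: "incseq (\<lambda>i. \<integral>\<^sup>+x. U i x \<partial>K)" for K
      using seq(3) by (auto simp: incseq_def le_fun_def intro!: nn_integral_mono)
    have eq: "(\<integral>\<^sup>+x. f x \<partial>K) = (SUP i. \<integral>\<^sup>+x. U i x \<partial>K)" if "sets K = sets A" for K
      unfolding seq(4) SUP_apply using seq(1,3) that
      by (intro nn_integral_monotone_convergence_SUP) (auto cong: measurable_cong_sets)
    have "(SUP i. (\<integral>\<^sup>+x. U i x \<partial>A) + c * (\<integral>\<^sup>+x. U i x \<partial>B))
        = (SUP i. \<integral>\<^sup>+x. U i x \<partial>A) + (SUP i. c * (\<integral>\<^sup>+x. U i x \<partial>B))"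
      using inc by (intro ennreal_SUP_add) (auto simp: incseq_def intro!: mult_left_mono)
    then show ?case
      unfolding seq(4)[symmetric] eq[OF refl] eq[OF sets(1)] eq[OF sets(2)] seq(5) by (simp add: SUP_mult_left_ennreal)
  qed
qed

text \<open>Every point outside the support has a null ball around it, and by the Lindelof property
  countably many such balls cover the complement.\<close>

lemma AE_in_msupport:
  fixes Q :: "'x::polish_space measure"
  assumes [measurable_cong]: "sets Q = sets borel"
  shows "AE x in Q. x \<in> msupport Q"
proof -
  define \<F> where "\<F> = {ball x e | x e. e > 0 \<and> emeasure Q (ball x e) = 0}"
  obtain \<G> where \<G>: "\<G> \<subseteq> \<F>" "countable \<G>" "\<Union>\<G> = \<Union>\<F>"
    using Lindelof[of \<F>] by (auto simp: \<F>_def)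
  have "\<G> \<subseteq> null_sets Q"
    using \<G>(1) by (auto simp: \<F>_def null_sets_def assms)
  then have "\<Union>\<G> \<in> null_sets Q"
    using \<G>(2) null_sets_UN'[of \<G> "\<lambda>x. x" Q] by auto
  then show ?thesis
  proof (rule AE_I')
    show "{x \<in> space Q. x \<notin> msupport Q} \<subseteq> \<Union>\<G>"
    proof
      fix x assume "x \<in> {x \<in> space Q. x \<notin> msupport Q}"
      then obtain e where "e > 0" "emeasure Q (ball x e) = 0" by (auto simp: msupport_def)
      then have "x \<in> ball x e" "ball x e \<in> \<F>" by (auto simp: \<F>_def)
      then show "x \<in> \<Union>\<G>" unfolding \<G>(3) by blast
    qed
  qed
qed

lemma finite_support_approximation:
  fixes Q :: "'x::polish_space measure" and F :: "('x \<Rightarrow> real) set"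
  assumes Q: "prob_space Q" and sets: "sets Q = sets borel"
    and F: "finite F" "\<And>f. f \<in> F \<Longrightarrow> continuous_on UNIV f" "\<And>f. f \<in> F \<Longrightarrow> bounded (range f)"
    and "\<epsilon> > 0"
  obtains m :: nat and p x where "\<And>i. i < m \<Longrightarrow> x i \<in> msupport Q" "\<And>i. 0 \<le> p i" "(\<Sum>i<m. p i) = 1"
    "\<And>f. f \<in> F \<Longrightarrow> \<bar>(\<integral>y. f y \<partial>Q) - (\<Sum>i<m. p i * f (x i))\<bar> \<le> \<epsilon>"
proof -
  interpret prob_space Q by fact
  note sets[measurable_cong]
  have F_meas: "f \<in> borel_measurable borel" if "f \<in> F" for f
    using F(2)[OF that] by (rule borel_measurable_continuous_onI)
  \<comment> \<open>The fibres of g are finitely many cells on which every member of F varies by at most \<open>\<epsilon>\<close>.\<close>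
  define g where "g x = (\<lambda>f\<in>F. \<lfloor>f x / \<epsilon>\<rfloor>)" for x
  define S where "S = msupport Q"
  have "finite (range g)"
  proof -
    have "finite ((\<lambda>x. \<lfloor>f x / \<epsilon>\<rfloor>) ` UNIV)" if f: "f \<in> F" for f
    proof -
      obtain C where C: "\<And>x. \<bar>f x\<bar> \<le> C" using F(3)[OF f] by (auto simp: bounded_iff)
      have "\<lfloor>f x / \<epsilon>\<rfloor> \<in> {\<lfloor>- C / \<epsilon>\<rfloor>..\<lfloor>C / \<epsilon>\<rfloor>}" for x
        using C[of x] \<open>\<epsilon> > 0\<close> unfolding atLeastAtMost_iff abs_le_iff
        by (intro conjI floor_mono divide_right_mono) linarith+
      then have "range (\<lambda>x. \<lfloor>f x / \<epsilon>\<rfloor>) \<subseteq> {\<lfloor>- C / \<epsilon>\<rfloor>..\<lfloor>C / \<epsilon>\<rfloor>}" by blast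
      then show ?thesis by (rule finite_subset) simp
    qed
    then have "finite (PiE F (\<lambda>f. (\<lambda>x. \<lfloor>f x / \<epsilon>\<rfloor>) ` UNIV))" using F(1) by (intro finite_PiE)
    then show ?thesis by (rule finite_subset[rotated]) (auto simp: g_def)
  qed
  then have fin: "finite (g ` S)" by (rule finite_subset[rotated]) auto
  define C where "C c = {x. g x = c}" for c
  have C_meas [measurable]: "C c \<in> sets borel" if "c \<in> g ` S" for c
  proof -
    have "C c = {x. \<forall>f\<in>F. \<lfloor>f x / \<epsilon>\<rfloor> = c f}"
      using that by (auto simp: C_def g_def fun_eq_iff)
    moreover have "{x \<in> space borel. \<forall>f\<in>F. \<lfloor>f x / \<epsilon>\<rfloor> = c f} \<in> sets borel"
    proof (rule sets.sets_Collect_finite_All[OF _ F(1)])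
      fix f assume "f \<in> F"
      note [measurable] = F_meas[OF this]
      show "{x \<in> space borel. \<lfloor>f x / \<epsilon>\<rfloor> = c f} \<in> sets borel" by measurable
    qed
    ultimately show ?thesis by simp
  qed
  define X where "X c = (SOME x. x \<in> S \<and> g x = c)" for c
  have X: "X c \<in> S" "g (X c) = c" if "c \<in> g ` S" for c
  proof -
    have "\<exists>x. x \<in> S \<and> g x = c" using that by auto
    from someI_ex[OF this] show "X c \<in> S" "g (X c) = c" by (auto simp: X_def)
  qed
  have AE_S: "AE x in Q. x \<in> S" unfolding S_def by (rule AE_in_msupport) fact
  have p1: "(\<Sum>c\<in>g ` S. prob (C c)) = 1"
  proof -
    have "(\<Sum>c\<in>g ` S. prob (C c)) = prob (\<Union>c\<in>g ` S. C c)"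
    proof (rule finite_measure_finite_Union[OF fin, symmetric])
      show "C ` (g ` S) \<subseteq> events" using C_meas unfolding sets by blast
      show "disjoint_family_on C (g ` S)" by (auto simp: disjoint_family_on_def C_def)
    qed
    also have "\<dots> = 1"
    proof -
      have "(\<Union>c\<in>g ` S. C c) \<in> events" using fin C_meas unfolding sets by (rule sets.finite_UN)
      moreover have "AE x in Q. x \<in> (\<Union>c\<in>g ` S. C c)"
        using AE_S by (rule eventually_mono) (auto simp: C_def)
      ultimately show ?thesis by (simp add: prob_eq_1)
    qed
    finally show ?thesis .
  qed
  have approx: "\<bar>(\<integral>y. f y \<partial>Q) - (\<Sum>c\<in>g ` S. prob (C c) * f (X c))\<bar> \<le> \<epsilon>" if f: "f \<in> F" for f
  proof -
    note [measurable] = F_meas[OF f]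
    define h where "h x = (\<Sum>c\<in>g ` S. f (X c) * indicator (C c) x)" for x
    have int_ind: "integrable Q (\<lambda>x. f (X c) * indicator (C c) x)" if "c \<in> g ` S" for c
      using C_meas[OF that] by (intro integrable_mult_right integrable_real_indicator) (auto simp: sets emeasure_eq_measure)
    have h_int: "integrable Q h"
      unfolding h_def using int_ind by (intro Bochner_Integration.integrable_sum) auto
    have h_eq: "(\<integral>x. h x \<partial>Q) = (\<Sum>c\<in>g ` S. prob (C c) * f (X c))"
      unfolding h_def using int_ind C_meas
      by (subst Bochner_Integration.integral_sum) (auto simp: sets mult.commute intro!: sum.cong)
    obtain B where B: "\<And>x. \<bar>f x\<bar> \<le> B" using F(3)[OF f] by (auto simp: bounded_iff)
    have f_int: "integrable Q f"
      using B by (intro integrable_const_bound[of _ B]) auto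
    have close: "\<bar>f x - h x\<bar> \<le> \<epsilon>" if "x \<in> S" for x
    proof -
      have "h x = (\<Sum>c\<in>g ` S. if c = g x then f (X c) else 0)"
        unfolding h_def by (intro sum.cong) (auto simp: C_def indicator_def)
      also have "\<dots> = f (X (g x))"
        using fin that by (subst sum.delta) auto
      finally have hx: "h x = f (X (g x))" .
      have "g (X (g x)) f = g x f" using X(2)[of "g x"] that by simp
      then have "\<lfloor>f (X (g x)) / \<epsilon>\<rfloor> = \<lfloor>f x / \<epsilon>\<rfloor>" using f by (simp add: g_def)
      \<comment> \<open>Two reals with the same floor differ by less than 1.\<close>
      then have "\<bar>f x / \<epsilon> - f (X (g x)) / \<epsilon>\<bar> \<le> 1" by linarith
      then show ?thesis
        using \<open>\<epsilon> > 0\<close> unfolding hx by (simp add: diff_divide_distrib[symmetric] abs_divide)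
    qed
    have "\<bar>\<integral>x. f x - h x \<partial>Q\<bar> \<le> (\<integral>x. \<bar>f x - h x\<bar> \<partial>Q)" by (rule integral_abs_bound)
    also have "\<dots> \<le> \<epsilon>"
      using AE_S close f_int h_int
      by (intro integral_le_const) (auto elim!: eventually_mono)
    finally show ?thesis using f_int h_int by (simp add: h_eq)
  qed
  obtain e where e: "bij_betw e {..<card (g ` S)} (g ` S)"
    using ex_bij_betw_nat_finite[OF fin] by (auto simp: atLeast0LessThan)
  show ?thesis
  proof (rule that[of "card (g ` S)" "\<lambda>i. X (e i)" "\<lambda>i. prob (C (e i))"])
    show "X (e i) \<in> msupport Q" if "i < card (g ` S)" for i
      using X(1)[of "e i"] bij_betwE[OF e] that by (auto simp: S_def)
    show "(\<Sum>i<card (g ` S). prob (C (e i))) = 1"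
      using sum.reindex_bij_betw[OF e, of "\<lambda>c. prob (C c)"] p1 by simp
    show "\<bar>(\<integral>y. f y \<partial>Q) - (\<Sum>i<card (g ` S). prob (C (e i)) * f (X (e i)))\<bar> \<le> \<epsilon>" if "f \<in> F" for f
      using sum.reindex_bij_betw[OF e, of "\<lambda>c. prob (C c) * f (X c)"] approx[OF that] by simp
  qed simp
qed

subsection \<open>The random measure\<close>

context
  fixes P0 :: "'x::topological_space measure" and v :: "nat \<Rightarrow> 'w \<Rightarrow> real" and \<theta> :: "nat \<Rightarrow> 'w \<Rightarrow> 'x"
  assumes P0: "sets P0 = sets borel"
begin

lemma sets_sb_random_measure: "sets (sb_random_measure P0 v \<theta> \<omega>) = sets borel"
  unfolding sb_random_measure_def using sets.sigma_sets_eq[of "borel :: 'x measure"] by simp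

text \<open>The formula holds for every \<open>\<omega>\<close>, also where some \<open>v i\<close>
  leaves the unit interval: \<open>ennreal\<close> sends negative weights and a negative leftover to
  0. Measurability in \<open>\<omega>\<close> can thus be read off everywhere.\<close>

lemma nn_integral_sb_random_measure:
  assumes f: "f \<in> borel_measurable borel"
  shows "(\<integral>\<^sup>+x. f x \<partial>sb_random_measure P0 v \<theta> \<omega>)
    = (\<Sum>j. ennreal (stick_weight v j \<omega>) * f (\<theta> j \<omega>))
      + ennreal (1 - (\<Sum>j. stick_weight v j \<omega>)) * (\<integral>\<^sup>+x. f x \<partial>P0)"
proof -
  define S where "S = sb_random_measure P0 v \<theta> \<omega>"
  define c where "c = ennreal (1 - (\<Sum>j. stick_weight v j \<omega>))"
  \<comment> \<open>The atomic part, as the image under \<open>\<theta>\<close> of the weights on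
    the natural numbers; it supplies the countable additivity of that part.\<close>
  define K where "K = distr (density (count_space UNIV) (\<lambda>j. ennreal (stick_weight v j \<omega>))) borel (\<lambda>j. \<theta> j \<omega>)"
  have sets_K: "sets K = sets borel" by (simp add: K_def)
  have nn_K: "(\<integral>\<^sup>+x. g x \<partial>K) = (\<Sum>j. ennreal (stick_weight v j \<omega>) * g (\<theta> j \<omega>))"
    if "g \<in> borel_measurable borel" for g
    using that unfolding K_def
    by (simp add: nn_integral_distr nn_integral_density nn_integral_count_space_nat)
  define \<mu> where "\<mu> A = (\<Sum>j. ennreal (stick_weight v j \<omega>) * indicator A (\<theta> j \<omega>)) + c * emeasure P0 A" for A
  have \<mu>: "\<mu> A = emeasure K A + c * emeasure P0 A" if "A \<in> sets borel" for A
    using nn_K[of "indicator A"] that by (simp add: \<mu>_def sets_K)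
  have S_eq: "S = measure_of UNIV (sets borel) \<mu>"
    unfolding S_def sb_random_measure_def \<mu>_def c_def ..
  have em: "emeasure S A = \<mu> A" if "A \<in> sets borel" for A
  proof (rule emeasure_measure_of[OF S_eq])
    have [simp]: "sets S = sets borel" by (simp add: S_def sets_sb_random_measure)
    show "sets borel \<subseteq> Pow (UNIV :: 'x set)" by simp
    show "A \<in> sets S" using that by simp
    show "positive (sets S) \<mu>" by (simp add: positive_def \<mu>)
    show "countably_additive (sets S) \<mu>"
    proof (rule countably_additiveI)
      fix A :: "nat \<Rightarrow> 'x set"
      assume A: "range A \<subseteq> sets S" "disjoint_family A" "(\<Union>i. A i) \<in> sets S"
      then have A': "A i \<in> sets borel" for i by auto
      have "(\<Sum>i. \<mu> (A i)) = (\<Sum>i. emeasure K (A i)) + (\<Sum>i. c * emeasure P0 (A i))"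
        unfolding \<mu>[OF A'] by (rule suminf_add[symmetric]) auto
      also have "(\<Sum>i. emeasure K (A i)) = emeasure K (\<Union>i. A i)"
        using A by (intro suminf_emeasure) (auto simp: sets_K)
      also have "(\<Sum>i. c * emeasure P0 (A i)) = c * emeasure P0 (\<Union>i. A i)"
        using A by (subst ennreal_suminf_cmult, subst suminf_emeasure) (auto simp: P0)
      finally show "(\<Sum>i. \<mu> (A i)) = \<mu> (\<Union>i. A i)"
        using A by (simp add: \<mu>)
    qed
  qed
  have "(\<integral>\<^sup>+x. f x \<partial>S) = (\<integral>\<^sup>+x. f x \<partial>K) + c * (\<integral>\<^sup>+x. f x \<partial>P0)"
  proof (rule nn_integral_add_scaled_measure)
    show "sets P0 = sets K" "sets S = sets K" by (simp_all add: P0 sets_K S_def sets_sb_random_measure)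
    show "emeasure S A = emeasure K A + c * emeasure P0 A" if "A \<in> sets K" for A
      using that by (simp add: em \<mu> sets_K)
    show "f \<in> borel_measurable K" using f by (simp add: sets_K cong: measurable_cong_sets)
  qed
  then show ?thesis
    using nn_K[OF f] by (simp add: S_def c_def)
qed

lemma borel_measurable_integral_sb_random_measure:
  fixes f :: "'x \<Rightarrow> real"
  assumes v: "\<And>j. v j \<in> borel_measurable M" and \<theta>: "\<And>j. \<theta> j \<in> borel_measurable M"
    and f: "f \<in> borel_measurable borel"
  shows "(\<lambda>\<omega>. \<integral>x. f x \<partial>sb_random_measure P0 v \<theta> \<omega>) \<in> borel_measurable M"
proof -
  note [measurable] = v \<theta> f
  let ?S = "sb_random_measure P0 v \<theta>"
  have w [measurable]: "stick_weight v j \<in> borel_measurable M" for j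
    unfolding stick_weight_def[abs_def] by measurable
  have nn [measurable]: "(\<lambda>\<omega>. \<integral>\<^sup>+x. g x \<partial>?S \<omega>) \<in> borel_measurable M"
    if [measurable]: "g \<in> borel_measurable borel" for g
    unfolding nn_integral_sb_random_measure[OF that] by measurable
  have f': "f \<in> borel_measurable (?S \<omega>)" for \<omega>
    using f by (simp add: sets_sb_random_measure cong: measurable_cong_sets)
  \<comment> \<open>On exceptional \<open>\<omega>\<close> the measure may be infinite and
    \<open>f\<close> not integrable; the Bochner integral is then 0 by convention. The case split is
    itself measurable.\<close>
  have eq: "(\<integral>x. f x \<partial>?S \<omega>) = (if (\<integral>\<^sup>+x. ennreal \<bar>f x\<bar> \<partial>?S \<omega>) < \<infinity>
      then enn2real (\<integral>\<^sup>+x. ennreal (f x) \<partial>?S \<omega>) - enn2real (\<integral>\<^sup>+x. ennreal (- f x) \<partial>?S \<omega>) else 0)" for \<omega>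
  proof (cases "integrable (?S \<omega>) f")
    case True
    then show ?thesis using real_lebesgue_integral_def[OF True] by (simp add: integrable_iff_bounded)
  next
    case False
    then show ?thesis using f' by (simp add: not_integrable_integral_eq integrable_iff_bounded)
  qed
  show ?thesis unfolding eq by measurable
qed

text \<open>Removing the first m atoms leaves a nonnegative measure whose mass is the last factor of
  the bound.\<close>

lemma
  assumes P0_prob: "prob_space P0" and w: "\<And>j. 0 \<le> stick_weight v j \<omega>"
    and le1: "\<And>n. (\<Sum>j<n. stick_weight v j \<omega>) \<le> 1"
  shows prob_space_sb_random_measure: "prob_space (sb_random_measure P0 v \<theta> \<omega>)"
    and integral_sb_random_measure_approx:
      "\<And>f B m. f \<in> borel_measurable borel \<Longrightarrow> (\<And>x. \<bar>f x\<bar> \<le> B) \<Longrightarrow>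
        \<bar>(\<integral>x. f x \<partial>sb_random_measure P0 v \<theta> \<omega>) - (\<Sum>j<m. stick_weight v j \<omega> * f (\<theta> j \<omega>))\<bar>
          \<le> B * (1 - (\<Sum>j<m. stick_weight v j \<omega>))"
proof -
  let ?w = "\<lambda>j. stick_weight v j \<omega>"
  let ?S = "sb_random_measure P0 v \<theta> \<omega>"
  have sm: "summable ?w" using w le1 by (intro summableI_nonneg_bounded)
  have le: "(\<Sum>j. ?w j) \<le> 1" using sm le1 by (intro suminf_le_const)
  have space_S: "space ?S = UNIV" using sets_eq_imp_space_eq[OF sets_sb_random_measure] by simp
  interpret P0: prob_space P0 by fact
  show "prob_space ?S"
  proof
    have "emeasure ?S (space ?S) = (\<integral>\<^sup>+x. 1 \<partial>?S)" by simp
    also have "\<dots> = (\<Sum>j. ennreal (?w j)) + ennreal (1 - (\<Sum>j. ?w j))"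
      by (subst nn_integral_sb_random_measure) (simp_all add: P0.emeasure_space_1)
    also have "(\<Sum>j. ennreal (?w j)) = ennreal (\<Sum>j. ?w j)" using w sm by (intro suminf_ennreal2)
    also have "\<dots> + ennreal (1 - (\<Sum>j. ?w j)) = 1"
      using le suminf_nonneg[OF sm w] by (simp flip: ennreal_plus)
    finally show "emeasure ?S (space ?S) = 1" .
  qed
  then interpret S: prob_space ?S .
  \<comment> \<open>For a nonnegative integrand the later atoms and the part from \<open>P0\<close>
    can only add to the integral.\<close>
  have lower: "(\<Sum>j<m. ?w j * g (\<theta> j \<omega>)) \<le> (\<integral>x. g x \<partial>?S)"
    if [measurable]: "g \<in> borel_measurable borel" and g: "\<And>x. 0 \<le> g x" "\<And>x. g x \<le> C" for g :: "'x \<Rightarrow> real" and C m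
  proof -
    have int: "integrable ?S g"
      using g by (intro S.integrable_const_bound[of _ C])
        (auto simp: sets_sb_random_measure cong: measurable_cong_sets)
    have "ennreal (\<Sum>j<m. ?w j * g (\<theta> j \<omega>)) = (\<Sum>j<m. ennreal (?w j) * ennreal (g (\<theta> j \<omega>)))"
      using w g by (simp add: sum_nonneg ennreal_mult' flip: sum_ennreal)
    also have "\<dots> \<le> (\<Sum>j. ennreal (?w j) * ennreal (g (\<theta> j \<omega>)))" by (rule sum_le_suminf) auto
    also have "\<dots> \<le> (\<integral>\<^sup>+x. ennreal (g x) \<partial>?S)" by (subst nn_integral_sb_random_measure) auto
    also have "\<dots> = ennreal (\<integral>x. g x \<partial>?S)" using int g by (intro nn_integral_eq_integral) auto
    finally show ?thesis using g by (subst (asm) ennreal_le_iff) (auto intro: integral_nonneg)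
  qed
  fix f :: "'x \<Rightarrow> real" and B m
  assume f [measurable]: "f \<in> borel_measurable borel" and B: "\<And>x. \<bar>f x\<bar> \<le> B"
  have int: "integrable ?S f"
    using B by (intro S.integrable_const_bound[of _ B]) (auto simp: sets_sb_random_measure cong: measurable_cong_sets)
  have B': "0 \<le> f x + B" "f x + B \<le> 2 * B" "0 \<le> B - f x" "B - f x \<le> 2 * B" for x
    using B[of x] by auto
  have "(\<Sum>j<m. ?w j * (f (\<theta> j \<omega>) + B)) \<le> (\<integral>x. f x + B \<partial>?S)"
    by (rule lower, measurable, rule B'(1), rule B'(2))
  moreover have "(\<Sum>j<m. ?w j * (B - f (\<theta> j \<omega>))) \<le> (\<integral>x. B - f x \<partial>?S)"
    by (rule lower, measurable, rule B'(3), rule B'(4))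
  \<comment> \<open>The two lower bounds, for \<open>B + f\<close> and \<open>B - f\<close>, control the integral of f from both sides.\<close>
  ultimately show "\<bar>(\<integral>x. f x \<partial>?S) - (\<Sum>j<m. ?w j * f (\<theta> j \<omega>))\<bar> \<le> B * (1 - (\<Sum>j<m. ?w j))"
    using int S.prob_space by (simp add: algebra_simps sum.distrib sum_subtractf sum_distrib_left abs_le_iff)
qed

end

subsection \<open>Full support\<close>

text \<open>If the partial sums reach 1 early, \<open>u k = 0 / 0 = 0\<close>, which is harmless since \<open>p k = 0\<close> as well.\<close>
lemma stick_inversion:
  fixes p :: "nat \<Rightarrow> real"
  assumes p: "\<And>i. 0 \<le> p i" and p1: "(\<Sum>i<m. p i) = 1"
  defines "u \<equiv> \<lambda>k. p k / (1 - (\<Sum>i<k. p i))"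
  assumes k: "k < m"
  shows "0 \<le> u k" "u k \<le> 1" "u k * (\<Prod>i<k. 1 - u i) = p k"
proof -
  have le: "p j \<le> 1 - (\<Sum>i<j. p i)" if "j < m" for j
  proof -
    have "(\<Sum>i<Suc j. p i) \<le> (\<Sum>i<m. p i)" using that p by (intro sum_mono2) auto
    then show ?thesis using p1 by simp
  qed
  have prod: "(\<Prod>i<j. 1 - u i) = 1 - (\<Sum>i<j. p i)" if "j \<le> m" for j
    using that
  proof (induction j)
    case (Suc j)
    show ?case
    proof (cases "(\<Sum>i<j. p i) = 1")
      case True
      then show ?thesis using Suc le[of j] p[of j] by simp
    next
      case False
      then have "(1 - (\<Sum>i<j. p i)) * (1 - u j) = 1 - (\<Sum>i<j. p i) - p j"
        by (simp add: u_def field_simps)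
      then show ?thesis using Suc by simp
    qed
  qed simp
  show "0 \<le> u k" using p[of k] le[OF k] by (simp add: u_def)
  show "u k \<le> 1" using p[of k] le[OF k] by (simp add: u_def divide_le_eq_1) linarith
  show "u k * (\<Prod>i<k. 1 - u i) = p k"
    using prod[of k] k le[OF k] p[of k] by (simp add: u_def)
qed

text \<open>A product of factors in the unit interval is 1-Lipschitz in each of them.\<close>

lemma stick_weight_diff_le:
  fixes x y :: "nat \<Rightarrow> real"
  assumes x: "\<And>i. i \<le> k \<Longrightarrow> x i \<in> {0..1}" and y: "\<And>i. i \<le> k \<Longrightarrow> y i \<in> {0..1}"
  shows "\<bar>x k * (\<Prod>i<k. 1 - x i) - y k * (\<Prod>i<k. 1 - y i)\<bar> \<le> (\<Sum>i\<le>k. \<bar>x i - y i\<bar>)"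
proof -
  \<comment> \<open>The last stick enters as \<open>z k\<close> rather than \<open>1 - z k\<close>;
    this puts the weight into the form of a single product.\<close>
  let ?a = "\<lambda>z i. if i = k then z i else 1 - z i :: real"
  have eq: "z k * (\<Prod>i<k. 1 - z i) = (\<Prod>i\<le>k. ?a z i)" for z
  proof -
    have "(\<Prod>i<k. ?a z i) = (\<Prod>i<k. 1 - z i)" by (intro prod.cong) auto
    then show ?thesis
      by (simp only: lessThan_Suc_atMost[symmetric] prod.lessThan_Suc if_True simp_thms mult.commute)
  qed
  have "norm ((\<Prod>i\<le>k. ?a x i) - (\<Prod>i\<le>k. ?a y i)) \<le> (\<Sum>i\<le>k. norm (?a x i - ?a y i))"
    by (rule norm_prod_diff) (use x y in \<open>auto simp: abs_le_iff\<close>)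
  also have "\<dots> = (\<Sum>i\<le>k. \<bar>x i - y i\<bar>)" by (intro sum.cong) auto
  finally show ?thesis unfolding eq by simp
qed

lemma (in prob_space) prob_iid_in_pos:
  fixes \<theta> :: "nat \<Rightarrow> 'a \<Rightarrow> 'x::topological_space"
  assumes iid: "indep_vars (\<lambda>_. borel) \<theta> UNIV"
    and law: "\<And>j. distr M borel (\<theta> j) = P0"
    and B: "\<And>i. B i \<in> sets borel" "\<And>i. i < m \<Longrightarrow> emeasure P0 (B i) > 0" and "m > 0"
  shows "prob {\<omega> \<in> space M. \<forall>i<m. \<theta> i \<omega> \<in> B i} > 0"
proof -
  have meas [measurable]: "\<theta> j \<in> borel_measurable M" for j
    using iid by (auto simp: indep_vars_def)
  have "prob {\<omega> \<in> space M. \<forall>i<m. \<theta> i \<omega> \<in> B i} = prob (\<Inter>i\<in>{..<m}. \<theta> i -` B i \<inter> space M)"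
    using \<open>m > 0\<close> by (intro arg_cong[of _ _ prob]) auto
  also have "\<dots> = (\<Prod>i<m. prob (\<theta> i -` B i \<inter> space M))"
    using iid B \<open>m > 0\<close> by (intro indep_varsD) auto
  also have "\<dots> > 0"
  proof (rule prod_pos)
    fix i assume "i \<in> {..<m}"
    then have "emeasure (distr M borel (\<theta> i)) (B i) > 0" using B(2)[of i] law by simp
    then show "prob (\<theta> i -` B i \<inter> space M) > 0"
      using B(1)[of i] by (simp add: emeasure_distr emeasure_eq_measure)
  qed
  finally show ?thesis .
qed

text \<open>Independence is given for the sigma-algebras of the whole sequences; constraints on
  finitely many coordinates are preimages of cylinders and so belong to them.\<close>

lemma (in prob_space) indep_set_vimage_prob:
  fixes v :: "nat \<Rightarrow> 'a \<Rightarrow> real" and \<theta> :: "nat \<Rightarrow> 'a \<Rightarrow> 'x::topological_space"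
  assumes indep: "indep_set
      (sets (vimage_algebra (space M) (\<lambda>\<omega> j. v j \<omega>) (Pi\<^sub>M UNIV (\<lambda>_. borel))))
      (sets (vimage_algebra (space M) (\<lambda>\<omega> j. \<theta> j \<omega>) (Pi\<^sub>M UNIV (\<lambda>_. borel))))"
    and A: "\<And>i. A i \<in> sets borel" and B: "\<And>i. B i \<in> sets borel"
  shows "prob {\<omega> \<in> space M. (\<forall>i<m. v i \<omega> \<in> A i) \<and> (\<forall>i<m. \<theta> i \<omega> \<in> B i)}
    = prob {\<omega> \<in> space M. \<forall>i<m. v i \<omega> \<in> A i} * prob {\<omega> \<in> space M. \<forall>i<m. \<theta> i \<omega> \<in> B i}"
proof -
  have vim: "{\<omega> \<in> space M. \<forall>i<m. X i \<omega> \<in> C i}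
      \<in> sets (vimage_algebra (space M) (\<lambda>\<omega> j. X j \<omega>) (Pi\<^sub>M UNIV (\<lambda>_. borel)))"
    if [measurable]: "\<And>i. C i \<in> sets borel" for X :: "nat \<Rightarrow> 'a \<Rightarrow> 'z::topological_space" and C
  proof -
    have "{g \<in> space (Pi\<^sub>M UNIV (\<lambda>_. borel)). \<forall>i<m. g i \<in> C i} \<in> sets (Pi\<^sub>M (UNIV :: nat set) (\<lambda>_. borel :: 'z measure))"
      by measurable
    then have "(\<lambda>\<omega> j. X j \<omega>) -` {g \<in> space (Pi\<^sub>M UNIV (\<lambda>_. borel)). \<forall>i<m. g i \<in> C i} \<inter> space M
      \<in> sets (vimage_algebra (space M) (\<lambda>\<omega> j. X j \<omega>) (Pi\<^sub>M UNIV (\<lambda>_. borel)))"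
      by (rule in_vimage_algebra)
    also have "(\<lambda>\<omega> j. X j \<omega>) -` {g \<in> space (Pi\<^sub>M UNIV (\<lambda>_. borel)). \<forall>i<m. g i \<in> C i} \<inter> space M
      = {\<omega> \<in> space M. \<forall>i<m. X i \<omega> \<in> C i}"
      by (auto simp: space_PiM)
    finally show ?thesis .
  qed
  have "{\<omega> \<in> space M. (\<forall>i<m. v i \<omega> \<in> A i) \<and> (\<forall>i<m. \<theta> i \<omega> \<in> B i)}
      = {\<omega> \<in> space M. \<forall>i<m. v i \<omega> \<in> A i} \<inter> {\<omega> \<in> space M. \<forall>i<m. \<theta> i \<omega> \<in> B i}" by auto
  then show ?thesis using indep_setD[OF indep vim[OF A] vim[OF B]] by simp
qed

lemma (in beta_markov_chain) full_support_stick_breaking: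
  fixes P0 :: "'x::polish_space measure" and \<theta> :: "nat \<Rightarrow> 'w \<Rightarrow> 'x"
  assumes P0: "prob_space P0" "sets P0 = sets borel"
    and law: "\<And>j. distr M borel (\<theta> j) = P0"
    and iid: "indep_vars (\<lambda>_. borel) \<theta> UNIV"
    and indep: "indep_set
      (sets (vimage_algebra (space M) (\<lambda>\<omega> j. v j \<omega>) (Pi\<^sub>M UNIV (\<lambda>_. borel))))
      (sets (vimage_algebra (space M) (\<lambda>\<omega> j. \<theta> j \<omega>) (Pi\<^sub>M UNIV (\<lambda>_. borel))))"
  shows "full_support M (sb_random_measure P0 v \<theta>) P0"
  unfolding full_support_def in_weak_support_def
proof (intro allI impI; elim conjE)
  fix Q :: "'x measure" and F :: "('x \<Rightarrow> real) set" and \<epsilon> :: real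
  assume Q: "prob_space Q" "sets Q = sets borel" "msupport Q \<subseteq> msupport P0"
    and F: "finite F" "\<forall>f\<in>F. continuous_on UNIV f \<and> bounded (range f)" and "\<epsilon> > 0"
  have \<theta>_meas [measurable]: "\<theta> j \<in> borel_measurable M" for j
    using iid by (auto simp: indep_vars_def)
  have F_meas: "f \<in> borel_measurable borel" if "f \<in> F" for f
    using F(2) that by (intro borel_measurable_continuous_onI) auto
  obtain C where C: "\<And>f x. f \<in> F \<Longrightarrow> \<bar>f x\<bar> \<le> C f"
  proof -
    have "\<exists>c. \<forall>x. \<bar>f x\<bar> \<le> c" if "f \<in> F" for f using F(2) that by (auto simp: bounded_iff)
    then show ?thesis using that by metis
  qed
  \<comment> \<open>Inserting 1 covers an empty \<open>F\<close> and makes division by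
    \<open>B\<close> safe.\<close>
  define B where "B = Max (insert 1 (C ` F))"
  have "B \<ge> 1" using F(1) by (simp add: B_def)
  have B: "\<bar>f x\<bar> \<le> B" if "f \<in> F" for f x
  proof -
    have "C f \<le> B" unfolding B_def using F(1) that by (intro Max_ge) auto
    then show ?thesis using C[OF that, of x] by linarith
  qed
  obtain m :: nat and p x where x: "\<And>i. i < m \<Longrightarrow> x i \<in> msupport Q"
    and p: "\<And>i. 0 \<le> p i" "(\<Sum>i<m. p i) = 1"
    and Q_approx: "\<And>f. f \<in> F \<Longrightarrow> \<bar>(\<integral>y. f y \<partial>Q) - (\<Sum>i<m. p i * f (x i))\<bar> \<le> \<epsilon> / 3"
  proof (rule finite_support_approximation[OF Q(1,2) F(1)])
    show "continuous_on UNIV f" "bounded (range f)" if "f \<in> F" for f using F(2) that by auto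
    show "\<epsilon> / 3 > 0" using \<open>\<epsilon> > 0\<close> by simp
  qed (rule that)
  have "m > 0" using p(2) by (cases m) auto
  define u where "u k = p k / (1 - (\<Sum>i<k. p i))" for k
  have u: "0 \<le> u k" "u k \<le> 1" "u k * (\<Prod>i<k. 1 - u i) = p k" if "k < m" for k
    using stick_inversion[OF p that] by (simp_all add: u_def)
  \<comment> \<open>If each of the first m sticks is within \<open>\<delta>\<close> of its target,
    each weight is within \<open>m * \<delta>\<close> and all m weights together within
    \<open>m * m * \<delta>\<close>. Times \<open>B\<close>, this is
    \<open>\<epsilon> / 12\<close>.\<close>
  define \<delta> where "\<delta> = \<epsilon> / (12 * B * real m * real m)"
  have "\<delta> > 0" using \<open>\<epsilon> > 0\<close> \<open>B \<ge> 1\<close> \<open>m > 0\<close> by (simp add: \<delta>_def)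
  have \<delta>: "B * (real m * (real m * \<delta>)) = \<epsilon> / 12"
    using \<open>B \<ge> 1\<close> \<open>m > 0\<close> by (simp add: \<delta>_def)
  define A where "A k = (if k < m then {u k - \<delta><..<u k + \<delta>} else {0<..<1})" for k
  define D where "D k = {y. \<forall>f\<in>F. \<bar>f y - f (x k)\<bar> < \<epsilon> / 3}" for k
  have D_open: "open (D k)" for k
  proof -
    have "open {y. \<bar>f y - f (x k)\<bar> < \<epsilon> / 3}" if "f \<in> F" for f
      using F(2) that by (intro open_Collect_less continuous_intros) auto
    moreover have "D k = (\<Inter>f\<in>F. {y. \<bar>f y - f (x k)\<bar> < \<epsilon> / 3})" by (auto simp: D_def)
    ultimately show ?thesis using F(1) by (auto intro: open_INT)
  qed
  have D_pos: "emeasure P0 (D k) > 0" if "k < m" for k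
  proof -
    have "x k \<in> D k" using \<open>\<epsilon> > 0\<close> by (simp add: D_def)
    then obtain e where "e > 0" "ball (x k) e \<subseteq> D k" using D_open openE by blast
    moreover have "emeasure P0 (ball (x k) e) > 0"
      using x[OF that] Q(3) \<open>e > 0\<close> by (auto simp: msupport_def)
    moreover have "D k \<in> sets P0" using D_open P0(2) by simp
    ultimately show ?thesis by (meson emeasure_mono less_le_trans)
  qed
  have [measurable]: "A k \<in> sets borel" "D k \<in> sets borel" for k
    using D_open by (simp_all add: A_def)
  have "\<exists>c d. {c<..<d} \<subseteq> A k \<and> 0 \<le> c \<and> c < d \<and> d \<le> 1" for k
  proof (cases "k < m")
    case True
    then show ?thesis
      using u[OF True] \<open>\<delta> > 0\<close>
      \<comment> \<open>The window clipped to the unit interval; it stays nondegenerate because its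
        centre lies in that interval.\<close>
      by (intro exI[of _ "max 0 (u k - \<delta>)"] exI[of _ "min 1 (u k + \<delta>)"]) (auto simp: A_def)
  next
    case False
    then show ?thesis by (intro exI[of _ 0] exI[of _ 1]) (auto simp: A_def)
  qed
  then have "prob {\<omega> \<in> space M. \<forall>i\<le>m - 1. v i \<omega> \<in> A i} > 0"
    by (intro prob_chain_pos) auto
  moreover have "i \<le> m - 1 \<longleftrightarrow> i < m" for i using \<open>m > 0\<close> by auto
  ultimately have A_pos: "prob {\<omega> \<in> space M. \<forall>i<m. v i \<omega> \<in> A i} > 0" by simp
  define E where "E = {\<omega> \<in> space M. (\<forall>i<m. v i \<omega> \<in> A i) \<and> (\<forall>i<m. \<theta> i \<omega> \<in> D i)}"
  have E_pos: "prob E > 0"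
    using A_pos prob_iid_in_pos[OF iid law _ D_pos \<open>m > 0\<close>]
    unfolding E_def by (subst indep_set_vimage_prob[OF indep]) auto
  define T where "T = {\<omega> \<in> space M. \<forall>f\<in>F. \<bar>(\<integral>x. f x \<partial>sb_random_measure P0 v \<theta> \<omega>) - (\<integral>x. f x \<partial>Q)\<bar> < \<epsilon>}"
  have "T \<in> events"
    unfolding T_def
  proof (rule sets.sets_Collect_finite_All[OF _ F(1)])
    fix f assume "f \<in> F"
    note [measurable] = borel_measurable_integral_sb_random_measure[OF P0(2) v_measurable \<theta>_meas F_meas[OF this]]
    show "{\<omega> \<in> space M. \<bar>(\<integral>x. f x \<partial>sb_random_measure P0 v \<theta> \<omega>) - (\<integral>x. f x \<partial>Q)\<bar> < \<epsilon>} \<in> events"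
      by measurable
  qed
  have "AE \<omega> in M. \<omega> \<in> E \<longrightarrow> \<omega> \<in> T"
    using AE_v_all
  proof (rule eventually_mono, intro impI)
    fix \<omega> assume v01: "\<forall>j. v j \<omega> \<in> {0<..<1}" and "\<omega> \<in> E"
    let ?w = "\<lambda>j. stick_weight v j \<omega>"
    let ?S = "sb_random_measure P0 v \<theta> \<omega>"
    have w: "0 \<le> ?w j" for j
      unfolding stick_weight_def
      using v01 by (intro mult_nonneg_nonneg prod_nonneg ballI) (auto intro: less_imp_le)
    have "0 \<le> (\<Prod>i<n. 1 - v i \<omega>)" for n
      using v01 by (intro prod_nonneg ballI) (auto intro: less_imp_le)
    then have le1: "(\<Sum>j<n. ?w j) \<le> 1" for n by (simp add: sum_stick_weight)
    have wp: "\<bar>?w k - p k\<bar> \<le> real m * \<delta>" if "k < m" for k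
    proof -
      have "\<bar>?w k - p k\<bar> \<le> (\<Sum>i\<le>k. \<bar>v i \<omega> - u i\<bar>)"
        unfolding stick_weight_def u(3)[OF that, symmetric]
        by (rule stick_weight_diff_le) (use v01 u that in \<open>auto intro: less_imp_le\<close>)
      also have "\<dots> \<le> (\<Sum>i\<le>k. \<delta>)"
      proof (rule sum_mono)
        fix i assume "i \<in> {..k}"
        then have "v i \<omega> \<in> A i" "i < m" using \<open>\<omega> \<in> E\<close> that by (auto simp: E_def)
        then show "\<bar>v i \<omega> - u i\<bar> \<le> \<delta>" by (auto simp: A_def)
      qed
      also have "\<dots> \<le> real m * \<delta>" using that \<open>\<delta> > 0\<close> by simp
      finally show ?thesis .
    qed
    have sum_wp: "(\<Sum>k<m. \<bar>?w k - p k\<bar>) \<le> real m * (real m * \<delta>)"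
      using sum_mono[of "{..<m}" "\<lambda>k. \<bar>?w k - p k\<bar>" "\<lambda>_. real m * \<delta>"] wp by simp
    have "\<bar>(\<integral>x. f x \<partial>?S) - (\<integral>x. f x \<partial>Q)\<bar> < \<epsilon>" if f: "f \<in> F" for f
    proof -
      have 1: "\<bar>(\<integral>x. f x \<partial>?S) - (\<Sum>j<m. ?w j * f (\<theta> j \<omega>))\<bar> \<le> B * (1 - (\<Sum>j<m. ?w j))"
        by (rule integral_sb_random_measure_approx[OF P0(2,1) w le1 F_meas[OF f] B[OF f]])
      \<comment> \<open>The target weights sum to 1, so the leftover mass is itself a total
        deviation of weights.\<close>
      have "1 - (\<Sum>j<m. ?w j) = (\<Sum>j<m. p j - ?w j)" using p(2) by (simp add: sum_subtractf)
      also have "\<dots> \<le> (\<Sum>k<m. \<bar>?w k - p k\<bar>)" by (intro sum_mono) auto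
      finally have "1 - (\<Sum>j<m. ?w j) \<le> real m * (real m * \<delta>)" using sum_wp by simp
      then have 2: "B * (1 - (\<Sum>j<m. ?w j)) \<le> \<epsilon> / 12"
        using \<open>B \<ge> 1\<close> unfolding \<delta>[symmetric] by (intro mult_left_mono) auto
      have "\<bar>\<Sum>j<m. (?w j - p j) * f (\<theta> j \<omega>)\<bar> \<le> (\<Sum>j<m. \<bar>?w j - p j\<bar> * B)"
        by (intro order.trans[OF sum_abs] sum_mono) (auto simp: abs_mult intro!: mult_left_mono B[OF f])
      also have "\<dots> = B * (\<Sum>k<m. \<bar>?w k - p k\<bar>)" by (simp add: sum_distrib_left mult.commute)
      also have "\<dots> \<le> \<epsilon> / 12"
        using \<open>B \<ge> 1\<close> sum_wp unfolding \<delta>[symmetric] by (intro mult_left_mono) auto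
      finally have 3: "\<bar>\<Sum>j<m. (?w j - p j) * f (\<theta> j \<omega>)\<bar> \<le> \<epsilon> / 12" .
      have "\<bar>\<Sum>j<m. p j * (f (\<theta> j \<omega>) - f (x j))\<bar> \<le> (\<Sum>j<m. p j * (\<epsilon> / 3))"
      proof (intro order.trans[OF sum_abs] sum_mono)
        fix j assume "j \<in> {..<m}"
        then have "\<bar>f (\<theta> j \<omega>) - f (x j)\<bar> \<le> \<epsilon> / 3" using \<open>\<omega> \<in> E\<close> f by (auto simp: E_def D_def intro: less_imp_le)
        then show "\<bar>p j * (f (\<theta> j \<omega>) - f (x j))\<bar> \<le> p j * (\<epsilon> / 3)"
          unfolding abs_mult abs_of_nonneg[OF p(1)] by (intro mult_left_mono p(1))
      qed
      also have "\<dots> = \<epsilon> / 3" by (simp only: sum_distrib_right[symmetric] p(2))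
      finally have 4: "\<bar>\<Sum>j<m. p j * (f (\<theta> j \<omega>) - f (x j))\<bar> \<le> \<epsilon> / 3" .
      \<comment> \<open>Leftover mass and change of weights cost \<open>\<epsilon> / 12\<close>
        each, moving the atoms and approximating \<open>Q\<close> cost \<open>\<epsilon> / 3\<close>
        each: together \<open>5 * \<epsilon> / 6\<close>.\<close>
      have "(\<Sum>j<m. ?w j * f (\<theta> j \<omega>)) - (\<Sum>j<m. p j * f (x j))
          = (\<Sum>j<m. (?w j - p j) * f (\<theta> j \<omega>)) + (\<Sum>j<m. p j * (f (\<theta> j \<omega>) - f (x j)))"
        by (simp add: sum_subtractf sum.distrib algebra_simps)
      with 1 2 3 4 Q_approx[OF f] \<open>\<epsilon> > 0\<close> show ?thesis by linarith
    qed
    then show "\<omega> \<in> T" using \<open>\<omega> \<in> E\<close> by (auto simp: T_def E_def)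
  qed
  then have "prob E \<le> prob T" using \<open>T \<in> events\<close> by (intro finite_measure_mono_AE) auto
  with E_pos show "measure M {\<omega> \<in> space M. \<forall>f\<in>F. \<bar>(\<integral>x. f x \<partial>sb_random_measure P0 v \<theta> \<omega>) - (\<integral>x. f x \<partial>Q)\<bar> < \<epsilon>} > 0"
    by (simp add: T_def)
qed

theorem mainTheorem10:
  fixes M :: "'w measure" and N :: nat and \<alpha> \<beta> :: "nat \<Rightarrow> real"
    and P0 :: "'x::polish_space measure"
    and v :: "nat \<Rightarrow> 'w \<Rightarrow> real" and \<theta> :: "nat \<Rightarrow> 'w \<Rightarrow> 'x"
  assumes M: "prob_space M"
    and pos: "\<And>j. \<alpha> j > 0" "\<And>j. \<beta> j > 0"
    and P0: "prob_space P0" "sets P0 = sets borel" "\<And>x. emeasure P0 {x} = 0"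
    and chain: "bmsb_chain M N \<alpha> \<beta> v"
    and th_meas: "\<And>j. \<theta> j \<in> borel_measurable M"
    and th_law: "\<And>j. distr M borel (\<theta> j) = P0"
    and th_iid: "prob_space.indep_vars M (\<lambda>_. borel) \<theta> UNIV"
    and indep: "prob_space.indep_set M
                  (sets (vimage_algebra (space M) (\<lambda>\<omega> j. v j \<omega>) (Pi\<^sub>M UNIV (\<lambda>_. borel))))
                  (sets (vimage_algebra (space M) (\<lambda>\<omega> j. \<theta> j \<omega>) (Pi\<^sub>M UNIV (\<lambda>_. borel))))"
  shows "((\<not> summable (\<lambda>j. \<alpha> j / (\<alpha> j + \<beta> j))) \<and>
            limsup (\<lambda>j. ereal (1 / (\<alpha> j + \<beta> j))) < \<infinity>
            \<longrightarrow> (AE \<omega> in M. (\<Sum>j. stick_weight v j \<omega>) = 1))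
         \<and> (\<forall>j. AE \<omega> in M. stick_weight v j \<omega> > 0)
         \<and> full_support M (sb_random_measure P0 v \<theta>) P0"
proof -
  interpret beta_markov_chain M N \<alpha> \<beta> v
    by (intro beta_markov_chain.intro beta_markov_chain_axioms.intro M pos chain)
  show ?thesis
    using AE_sum_stick_weight_eq_1 AE_stick_weight_pos
      full_support_stick_breaking[OF P0(1,2) th_law th_iid indep] by blast
qed

end
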